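(* Suppose $T_{\mathrm u}(X\mid Y)<\infty$. Then for every $0\le\varepsilon\le1$, $$L^*_{\mathrm{avg}}(n,\varepsilon,X,Y) = n(1-\varepsilon)H(X\mid Y) - \sqrt{n\,V_{\mathrm u}(X\mid Y)}\,f_{\mathrm G}(\varepsilon) + O(\log n)\quad (n\to\infty).$$
   Context: Setting: $\mathcal{X}=\{1,2,\dots\}$ with its power set, $\mathcal{Y}$ an arbitrary measurable space, $X$ an $\mathcal{X}$-valued and $Y$ a $\mathcal{Y}$-valued random variable. Logarithms are base 2. $P_{X|Y}(x\mid Y)$ is a version of $\mathbb{P}\{X=x\mid Y\}$; $\iota(X\mid Y):=\log(1/P_{X|Y}(X\mid Y))$. $H(X\mid Y):=\mathbb{E}[\iota(X\mid Y)]$, $V_{\mathrm u}(X\mid Y):=\mathbb{E}[(\iota(X\mid Y)-H(X\mid Y))^2]$, $T_{\mathrm u}(X\mid Y):=\mathbb{E}[|\iota(X\mid Y)-H(X\mid Y)|^3]$. $(X_i,Y_i)$, $i=1,\dots,n$, are i.i.d. copies of $(X,Y)$, $X^n=(X_1,\dots,X_n)$, $Y^n=(Y_1,\dots,Y_n)$. $\varphi(t)=e^{-t^2/2}/\sqrt{2\pi}$, $\Phi$ the standard Gaussian CDF, $f_{\mathrm G}(s):=\varphi(\Phi^{-1}(s))$ for $0<s<1$ and $f_{\mathrm G}(0)=f_{\mathrm G}(1)=0$. Codes: $\{0,1\}^*$ is the set of finite binary strings including the empty string $\varnothing$, and $\ell(\mathbf b)$ is the length of $\mathbf b$. A variable-length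 stochastic code is a pair of random (possibly randomized) maps $F_n:\mathcal X^n\times\mathcal Y^n\to\{0,1\}^*$, $G_n:\{0,1\}^*\times\mathcal Y^n\to\mathcal X^n$ such that $F_n(X^n,Y^n)$ and $G_n(F_n(X^n,Y^n),Y^n)$ are random variables. It is an $(n,L,\varepsilon)_{\mathrm{avg}}$-code if $\mathbb{E}[\ell(F_n(X^n,Y^n))]\le L$ and $\mathbb{P}\{X^n\ne G_n(F_n(X^n,Y^n),Y^n)\}\le\varepsilon$. $L^*_{\mathrm{avg}}(n,\varepsilon,X,Y):=\inf\{L>0:\text{an }(n,L,\varepsilon)_{\mathrm{avg}}\text{-code exists}\}$. *)

theory Defs
  imports "HOL-Probability.Probability" "HOL-Library.Landau_Symbols"
begin

definition Phi :: "real \<Rightarrow> real" where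
  "Phi t = measure (density lborel std_normal_density) {..t}"

definition fG :: "real \<Rightarrow> real" where
  "fG s = (if 0 < s \<and> s < 1 then std_normal_density (THE t. Phi t = s) else 0)"

definition is_cond_pmf ::
  "'a measure \<Rightarrow> ('a \<Rightarrow> nat) \<Rightarrow> 'b measure \<Rightarrow> ('a \<Rightarrow> 'b) \<Rightarrow> (nat \<Rightarrow> 'b \<Rightarrow> real) \<Rightarrow> bool" where
  "is_cond_pmf M X N Y p \<longleftrightarrow>
     (\<forall>x. p x \<in> borel_measurable N \<and>
        (AE w in M. p x (Y w) =
           real_cond_exp M (vimage_algebra (space M) Y N) (indicator {w\<in>space M. X w = x}) w))"

definition cinfo :: "('a \<Rightarrow> nat) \<Rightarrow> ('a \<Rightarrow> 'b) \<Rightarrow> (nat \<Rightarrow> 'b \<Rightarrow> real) \<Rightarrow> 'a \<Rightarrow> real" where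
  "cinfo X Y p w = log 2 (1 / p (X w) (Y w))"

definition condH :: "'a measure \<Rightarrow> ('a \<Rightarrow> nat) \<Rightarrow> ('a \<Rightarrow> 'b) \<Rightarrow> (nat \<Rightarrow> 'b \<Rightarrow> real) \<Rightarrow> real" where
  "condH M X Y p = (\<integral>w. cinfo X Y p w \<partial>M)"

definition condV :: "'a measure \<Rightarrow> ('a \<Rightarrow> nat) \<Rightarrow> ('a \<Rightarrow> 'b) \<Rightarrow> (nat \<Rightarrow> 'b \<Rightarrow> real) \<Rightarrow> real" where
  "condV M X Y p = (\<integral>w. (cinfo X Y p w - condH M X Y p)^2 \<partial>M)"

text \<open>T_u(X|Y) < infinity: iota is integrable (so H is finite) and |iota - H|^3 is integrable.\<close>
definition condT_finite :: "'a measure \<Rightarrow> ('a \<Rightarrow> nat) \<Rightarrow> ('a \<Rightarrow> 'b) \<Rightarrow> (nat \<Rightarrow> 'b \<Rightarrow> real) \<Rightarrow> bool" where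
  "condT_finite M X Y p \<longleftrightarrow> integrable M (cinfo X Y p) \<and>
     integrable M (\<lambda>w. \<bar>cinfo X Y p w - condH M X Y p\<bar>^3)"

definition PXY :: "'a measure \<Rightarrow> ('a \<Rightarrow> nat) \<Rightarrow> 'b measure \<Rightarrow> ('a \<Rightarrow> 'b) \<Rightarrow> (nat \<times> 'b) measure" where
  "PXY M X N Y = distr M (count_space UNIV \<Otimes>\<^sub>M N) (\<lambda>w. (X w, Y w))"

definition Pn :: "'a measure \<Rightarrow> ('a \<Rightarrow> nat) \<Rightarrow> 'b measure \<Rightarrow> ('a \<Rightarrow> 'b) \<Rightarrow> nat \<Rightarrow> (nat \<Rightarrow> nat \<times> 'b) measure" where
  "Pn M X N Y n = PiM {..<n} (\<lambda>_. PXY M X N Y)"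

definition xs_of :: "nat \<Rightarrow> (nat \<Rightarrow> nat \<times> 'b) \<Rightarrow> (nat \<Rightarrow> nat)" where
  "xs_of n z = (\<lambda>i\<in>{..<n}. fst (z i))"

definition ys_of :: "nat \<Rightarrow> (nat \<Rightarrow> nat \<times> 'b) \<Rightarrow> (nat \<Rightarrow> 'b)" where
  "ys_of n z = (\<lambda>i\<in>{..<n}. snd (z i))"

definition avg_code ::
  "'a measure \<Rightarrow> ('a \<Rightarrow> nat) \<Rightarrow> 'b measure \<Rightarrow> ('a \<Rightarrow> 'b) \<Rightarrow> nat \<Rightarrow> real \<Rightarrow> real \<Rightarrow>
   ((nat \<Rightarrow> nat \<times> 'b) \<Rightarrow> bool list measure) \<Rightarrow>
   (bool list \<times> (nat \<Rightarrow> 'b) \<Rightarrow> (nat \<Rightarrow> nat) measure) \<Rightarrow> bool" where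
  "avg_code M X N Y n L \<epsilon> E D \<longleftrightarrow>
     E \<in> Pn M X N Y n \<rightarrow>\<^sub>M prob_algebra (count_space UNIV) \<and>
     D \<in> (count_space UNIV \<Otimes>\<^sub>M PiM {..<n} (\<lambda>_. N)) \<rightarrow>\<^sub>M
            prob_algebra (PiM {..<n} (\<lambda>_. count_space UNIV)) \<and>
     (\<integral>\<^sup>+ z. (\<integral>\<^sup>+ b. ennreal (real (length b)) \<partial>E z) \<partial>Pn M X N Y n) \<le> ennreal L \<and>
     (\<integral>\<^sup>+ z. (\<integral>\<^sup>+ b. emeasure (D (b, ys_of n z))
                 (space (PiM {..<n} (\<lambda>_. count_space UNIV)) - {xs_of n z}) \<partial>E z)
        \<partial>Pn M X N Y n) \<le> ennreal \<epsilon>"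

definition Lstar_avg ::
  "'a measure \<Rightarrow> ('a \<Rightarrow> nat) \<Rightarrow> 'b measure \<Rightarrow> ('a \<Rightarrow> 'b) \<Rightarrow> nat \<Rightarrow> real \<Rightarrow> real" where
  "Lstar_avg M X N Y n \<epsilon> = Inf {L. L > 0 \<and> (\<exists>E D. avg_code M X N Y n L \<epsilon> E D)}"

end

theory Submission
  imports Defs
begin

text \<open>
  Write \<open>S\<close> for the total information of \<open>X\<^sup>n\<close> given \<open>Y\<^sup>n\<close>, a sum of i.i.d. terms with mean \<open>H\<close> and
  variance \<open>V\<close>. Up to \<open>O(log n)\<close>, the optimal length is the least value of \<open>E[(1 - T) S]\<close> over tests
  \<open>T\<close> with \<open>E[T] = \<epsilon>\<close>, where \<open>T\<close> is the probability of giving up, and by duality this is the maximum over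
  \<open>t\<close> of \<open>E[S] - E[max 0 (S - t)] - t \<epsilon>\<close>.

  Achievability: encode \<open>x\<close> by its rank in the order of decreasing conditional probability, and the
  empty string when giving up. Converse: give each string \<open>b\<close> a weight of about
  \<open>2 powr - length b\<close> and compare the mass that the decoder then puts on \<open>x\<close> with the
  conditional probability of \<open>x\<close>, using \<open>ln a \<le> a - 1\<close>.

  The excess \<open>E[max 0 (S - t)]\<close> is replaced by its Gaussian counterpart by Lindeberg's exchange
  argument. For this piecewise linear function the \<open>k\<close>-th exchange costs \<open>O(1/k)\<close>, hence \<open>O(log n)\<close>
  altogether, and no Berry-Esseen bound is needed. Optimizing over \<open>t\<close> gives the term with
  \<open>fG \<epsilon>\<close>.
\<close>

section \<open>The Gaussian hinge function\<close>

text \<open>The kink of the positive part is the obstacle: third derivatives explode as the variance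
  tends to 0. By homogeneity, \<open>hinge x v = sqrt v * hinge (x / sqrt v) 1\<close>, so the third
  derivative in \<open>x\<close> is of order \<open>1 / v\<close>. The exchange therefore starts at
  variance 1, at a cost of at most 1. Before exchange \<open>k\<close> the variance is
  \<open>1 + k * Vw\<close>, and the errors form a harmonic sum. If \<open>Vw = 0\<close> there is
  nothing to exchange.

  The duality is used without locating any quantile of \<open>S\<close>. For the upper bound, the
  position of the test is whatever its mean forces, and the Legendre inequality holds at every
  position. For the lower bound, the threshold is free, and the Gaussian optimizer
  \<open>sqrt v * q\<close> is inserted. At \<open>\<epsilon> = 0\<close> and
  \<open>\<epsilon> = 1\<close> no such \<open>q\<close> exists, so these are treated apart.

  The converse pays twice for summable weights: normalizing them by \<open>4 * n\<close> costs
  \<open>2 + log 2 n\<close> bits, and the exponent \<open>1 + 1 / n\<close> costs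
  \<open>L / n\<close>. The latter is at most \<open>H\<close> as long as \<open>L\<close> is below
  \<open>n * H\<close>, and above that nothing is to be shown.\<close>

lemma prob_space_std_normal: "prob_space (density lborel std_normal_density)"
  by (rule prob_space_normal_density) simp

lemma std_normal_density_le_1: "std_normal_density x \<le> 1"
proof -
  have "exp (- x\<^sup>2 / 2) \<le> 1" by simp
  moreover have "1 \<le> sqrt (2 * pi)" using pi_gt3 by (simp add: real_le_rsqrt)
  ultimately have "exp (- x\<^sup>2 / 2) \<le> sqrt (2 * pi)" by linarith
  then show ?thesis
    unfolding std_normal_density_def by (simp add: field_simps)
qed

text \<open>Together with the bounds before and after it, this controls the derivatives of
  \<open>hinge\<close> uniformly in \<open>x\<close>.\<close>

lemma power2_mult_std_normal_density_le_1: "x\<^sup>2 * std_normal_density x \<le> 1"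
proof -
  have "x\<^sup>2 / 2 \<le> exp (x\<^sup>2 / 2)" using exp_ge_add_one_self[of "x\<^sup>2/2"] by linarith
  then have "x\<^sup>2 * exp (- x\<^sup>2 / 2) \<le> 2" by (simp add: exp_minus field_simps)
  moreover have "2 \<le> sqrt (2 * pi)" using pi_gt3 by (simp add: real_le_rsqrt)
  ultimately show ?thesis
    unfolding std_normal_density_def by (simp add: field_simps)
qed

lemma abs_mult_std_normal_density_le_1: "\<bar>x\<bar> * std_normal_density x \<le> 1"
proof (cases "\<bar>x\<bar> \<le> 1")
  case True
  then show ?thesis
    using std_normal_density_le_1[of x] by (intro mult_le_one) auto
next
  case False
  then have "\<bar>x\<bar> * std_normal_density x \<le> x\<^sup>2 * std_normal_density x"
    using mult_right_mono[of 1 "\<bar>x\<bar>" "\<bar>x\<bar>"]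
    by (intro mult_right_mono) (auto simp: power2_eq_square abs_mult_self_eq)
  then show ?thesis using power2_mult_std_normal_density_le_1[of x] by linarith
qed

lemma has_real_derivative_std_normal_density:
  "(std_normal_density has_real_derivative - x * std_normal_density x) (at x)"
  unfolding std_normal_density_def by (auto intro!: derivative_eq_intros simp: field_simps)

lemma continuous_on_std_normal_density: "continuous_on S std_normal_density"
  by (rule DERIV_continuous_on[OF has_field_derivative_at_within[OF has_real_derivative_std_normal_density]])

lemma Phi_diff:
  assumes "a \<le> t"
  shows "Phi t - Phi a = integral {a..t} std_normal_density"
proof -
  interpret G: prob_space "density lborel std_normal_density" by (rule prob_space_std_normal)
  have "Phi t = Phi a + measure (density lborel std_normal_density) {a<..t}"
    unfolding Phi_def using assms
    by (subst G.finite_measure_Union[symmetric]) (auto intro!: arg_cong[where f="measure _"])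
  moreover have "measure (density lborel std_normal_density) {a<..t}
      = set_lebesgue_integral lborel {a<..t} std_normal_density"
    unfolding set_lebesgue_integral_def
    by (simp add: measure_def emeasure_density integral_eq_nn_integral ennreal_mult'
        ennreal_indicator mult.commute)
  moreover have "\<dots> = set_lebesgue_integral lborel {a..t} std_normal_density"
    by (rule set_integral_cong_set)
      (auto simp: set_borel_measurable_def intro!: AE_I[where N="{a}"])
  moreover have "\<dots> = integral {a..t} std_normal_density"
    by (intro set_borel_integral_eq_integral borel_integrable_atLeastAtMost'
        continuous_on_std_normal_density)
  ultimately show ?thesis by simp
qed

lemma Phi_has_real_derivative:
  "(Phi has_real_derivative std_normal_density x) (at x)"
proof -
  have "continuous_on {x-1..x+1} std_normal_density"
    by (rule continuous_on_std_normal_density)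
  then have "((\<lambda>u. integral {x-1..u} std_normal_density) has_real_derivative std_normal_density x)
      (at x within {x-1..x+1})"
    by (rule integral_has_real_derivative) auto
  then have d: "((\<lambda>u. Phi (x-1) + integral {x-1..u} std_normal_density)
      has_real_derivative std_normal_density x) (at x within {x-1..x+1})"
    by (auto intro!: derivative_eq_intros)
  have "Phi (x-1) + integral {x-1..u} std_normal_density = Phi u" if "x - 1 \<le> u" for u
    using Phi_diff[OF that] by simp
  then have "(Phi has_real_derivative std_normal_density x) (at x within {x-1..x+1})"
    by (intro has_field_derivative_transform_within[OF d, of 1]) auto
  then show ?thesis
    by (simp add: at_within_Icc_at)
qed

lemma Phi_real_cdf: "Phi = cdf (density lborel std_normal_density)"
  by (auto simp: Phi_def cdf_def)

lemma Phi_tendsto_0: "(Phi \<longlongrightarrow> 0) at_bot"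
proof -
  interpret real_distribution "density lborel std_normal_density"
    using prob_space_std_normal by (simp add: real_distribution_def real_distribution_axioms_def)
  show ?thesis unfolding Phi_real_cdf by (rule cdf_lim_at_bot)
qed

lemma Phi_tendsto_1: "(Phi \<longlongrightarrow> 1) at_top"
proof -
  interpret real_distribution "density lborel std_normal_density"
    using prob_space_std_normal by (simp add: real_distribution_def real_distribution_axioms_def)
  show ?thesis unfolding Phi_real_cdf by (rule cdf_lim_at_top_prob)
qed

lemma Phi_strict_mono: "x < y \<Longrightarrow> Phi x < Phi y"
  by (rule DERIV_pos_imp_increasing)
    (use Phi_has_real_derivative normal_density_pos[OF zero_less_one] in blast)+

lemma Phi_nonneg: "0 \<le> Phi x"
  by (simp add: Phi_def)

lemma Phi_le_1: "Phi x \<le> 1"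
  using prob_space.prob_le_1[OF prob_space_std_normal] by (simp add: Phi_def)

lemma Phi_surj:
  assumes "0 < s" "s < 1"
  obtains q where "Phi q = s"
proof -
  obtain a where a: "Phi a < s"
    using order_tendstoD(2)[OF Phi_tendsto_0, of s] assms
    by (auto simp: eventually_at_bot_linorder)
  obtain b where b: "s < Phi b"
    using order_tendstoD(1)[OF Phi_tendsto_1, of s] assms
    by (auto simp: eventually_at_top_linorder)
  have "a \<le> b" using Phi_strict_mono[of b a] a b by (cases "a \<le> b") auto
  have "\<exists>x\<ge>a. x \<le> b \<and> Phi x = s"
    by (rule IVT') (use a b \<open>a \<le> b\<close> DERIV_continuous_on[OF has_field_derivative_at_within[OF Phi_has_real_derivative]] in auto)
  then show ?thesis using that by blast
qed

text \<open>Strict monotonicity of \<open>Phi\<close> resolves the definite description in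
  \<open>fG\<close>.\<close>

lemma fG_Phi: "0 < Phi q \<Longrightarrow> Phi q < 1 \<Longrightarrow> fG (Phi q) = std_normal_density q"
proof -
  assume "0 < Phi q" "Phi q < 1"
  moreover have "(THE t. Phi t = Phi q) = q"
    using Phi_strict_mono by (intro the_equality) (auto, metis linorder_neq_iff)
  ultimately show ?thesis by (simp add: fG_def)
qed

lemma fG_nonneg: "0 \<le> fG s" and fG_le_1: "fG s \<le> 1"
  by (auto simp: fG_def std_normal_density_le_1)

text \<open>The expectation of \<open>max 0 (x + sqrt v * G)\<close> for a standard Gaussian variable \<open>G\<close>. It solves the heat
  equation in \<open>x\<close> and \<open>v\<close>.\<close>

definition hinge :: "real \<Rightarrow> real \<Rightarrow> real" where
  "hinge x v = sqrt v * std_normal_density (x / sqrt v) + x * Phi (x / sqrt v)"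

lemma sqrt_div_self: "v > 0 \<Longrightarrow> sqrt v / v = 1 / sqrt v"
  by (simp add: sqrt_divide_self_eq inverse_eq_divide)

text \<open>The derivative of the density is \<open>- x\<close> times the density, so the two
  density terms of the product rule cancel and only \<open>Phi\<close> survives.\<close>

lemma hinge_deriv_x:
  assumes "v > 0"
  shows "((\<lambda>x. hinge x v) has_real_derivative Phi (x / sqrt v)) (at x)"
proof -
  have d: "((\<lambda>x. x / sqrt v) has_real_derivative 1 / sqrt v) (at x)"
    by (intro DERIV_cdivide DERIV_ident)
  have "((\<lambda>x. sqrt v * std_normal_density (x / sqrt v) + x * Phi (x / sqrt v)) has_real_derivative
      - (x / sqrt v) * std_normal_density (x / sqrt v) * (1 / sqrt v) * sqrt v
      + (Phi (x / sqrt v) + x * (std_normal_density (x / sqrt v) * (1 / sqrt v)))) (at x)"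
    using DERIV_add[OF
        DERIV_cmult[OF DERIV_chain2[OF has_real_derivative_std_normal_density d], of "sqrt v"]
        DERIV_mult[OF DERIV_ident DERIV_chain2[OF Phi_has_real_derivative d]]]
    by (simp add: mult_ac)
  then show ?thesis
    unfolding hinge_def by (rule DERIV_cong) (use assms in \<open>auto simp: divide_simps mult.assoc\<close>)
qed

lemma has_real_derivative_div_sqrt:
  assumes "v > 0"
  shows "((\<lambda>v. x / sqrt v) has_real_derivative - x / (2 * v * sqrt v)) (at v)"
proof -
  have "((\<lambda>v. x / sqrt v) has_real_derivative (0 * sqrt v - x * (inverse (sqrt v) / 2)) / (sqrt v * sqrt v)) (at v)"
    using assms by (intro DERIV_divide DERIV_const DERIV_real_sqrt) auto
  then show ?thesis
    by (rule DERIV_cong) (use assms in \<open>simp add: field_simps sqrt_div_self\<close>)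
qed

text \<open>This is half of the second derivative in \<open>x\<close> given by
  \<open>hinge_deriv2_x\<close>, that is, the heat equation. It makes the second-order terms cancel
  in \<open>lindeberg_step\<close>.\<close>

lemma hinge_deriv_v:
  assumes "v > 0"
  shows "((\<lambda>v. hinge x v) has_real_derivative std_normal_density (x / sqrt v) / (2 * sqrt v)) (at v)"
proof -
  note d = has_real_derivative_div_sqrt[OF assms, of x]
  have "((\<lambda>v. sqrt v * std_normal_density (x / sqrt v) + x * Phi (x / sqrt v)) has_real_derivative
      (inverse (sqrt v) / 2) * std_normal_density (x / sqrt v)
      + (- (x / sqrt v) * std_normal_density (x / sqrt v) * (- x / (2 * v * sqrt v))) * sqrt v
      + x * (std_normal_density (x / sqrt v) * (- x / (2 * v * sqrt v)))) (at v)"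
    by (intro DERIV_add DERIV_mult DERIV_cmult DERIV_real_sqrt assms
        DERIV_chain2[OF has_real_derivative_std_normal_density d]
        DERIV_chain2[OF Phi_has_real_derivative d])
  then show ?thesis
    unfolding hinge_def by (rule DERIV_cong) (use assms in \<open>simp add: field_simps\<close>)
qed

lemma hinge_deriv2_v:
  assumes "v > 0"
  shows "((\<lambda>v. std_normal_density (x / sqrt v) / (2 * sqrt v)) has_real_derivative
    ((x / sqrt v)\<^sup>2 - 1) * std_normal_density (x / sqrt v) / (4 * v * sqrt v)) (at v)"
proof -
  note d = has_real_derivative_div_sqrt[OF assms, of x]
  have "((\<lambda>v. std_normal_density (x / sqrt v) / (2 * sqrt v)) has_real_derivative
      ((- (x / sqrt v) * std_normal_density (x / sqrt v) * (- x / (2 * v * sqrt v))) * (2 * sqrt v)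
       - std_normal_density (x / sqrt v) * (2 * (inverse (sqrt v) / 2))) / ((2 * sqrt v) * (2 * sqrt v))) (at v)"
    using assms
    by (intro DERIV_divide DERIV_cmult DERIV_real_sqrt
        DERIV_chain2[OF has_real_derivative_std_normal_density d]) auto
  then show ?thesis
    by (rule DERIV_cong) (use assms in \<open>simp add: field_simps power2_eq_square\<close>)
qed

lemma hinge_deriv2_x:
  assumes "v > 0"
  shows "((\<lambda>x. Phi (x / sqrt v)) has_real_derivative std_normal_density (x / sqrt v) / sqrt v) (at x)"
proof -
  have d: "((\<lambda>x. x / sqrt v) has_real_derivative 1 / sqrt v) (at x)"
    by (intro DERIV_cdivide DERIV_ident)
  show ?thesis
    by (rule DERIV_cong[OF DERIV_chain2[OF Phi_has_real_derivative d]])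
      (use assms in \<open>simp add: field_simps sqrt_div_self\<close>)
qed

lemma hinge_deriv3_x:
  assumes "v > 0"
  shows "((\<lambda>x. std_normal_density (x / sqrt v) / sqrt v) has_real_derivative
    - (x / sqrt v) * std_normal_density (x / sqrt v) / v) (at x)"
proof -
  have d: "((\<lambda>x. x / sqrt v) has_real_derivative 1 / sqrt v) (at x)"
    by (intro DERIV_cdivide DERIV_ident)
  show ?thesis
    using assms
    by (intro DERIV_cong[OF DERIV_cdivide[OF DERIV_chain2[OF has_real_derivative_std_normal_density d]]])
      (simp add: field_simps sqrt_div_self)
qed

text \<open>The third derivative is \<open>- y * std_normal_density y / v\<close> with
  \<open>y = t / sqrt v\<close>, which is at most \<open>1 / v\<close> in absolute value. The decay
  in \<open>v\<close> is what later produces a logarithm instead of a linear error.\<close>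

lemma hinge_taylor_x:
  assumes "v > 0"
  shows "\<bar>hinge (x + w) v - hinge x v - Phi (x / sqrt v) * w
     - std_normal_density (x / sqrt v) / (2 * sqrt v) * w\<^sup>2\<bar> \<le> \<bar>w\<bar> ^ 3 / v"
proof (cases "w = 0")
  case False
  define d where "d = (\<lambda>m::nat. if m = 0 then (\<lambda>x. hinge x v) else if m = 1 then (\<lambda>x. Phi (x / sqrt v))
    else if m = 2 then (\<lambda>x. std_normal_density (x / sqrt v) / sqrt v)
    else (\<lambda>x. - (x / sqrt v) * std_normal_density (x / sqrt v) / v))"
  have "\<exists>t. (if x + w < x then x + w < t \<and> t < x else x < t \<and> t < x + w) \<and>
      hinge (x + w) v = (\<Sum>m<3. (d m x / fact m) * (x + w - x)^m) + (d 3 t / fact 3) * (x + w - x)^3"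
  proof (rule Taylor[where a="min x (x + w)" and b="max x (x + w)"])
    show "\<forall>m t. m < 3 \<and> min x (x + w) \<le> t \<and> t \<le> max x (x + w) \<longrightarrow>
        (d m has_real_derivative d (Suc m) t) (at t)"
    proof (intro allI impI)
      fix m :: nat and t assume "m < 3 \<and> min x (x + w) \<le> t \<and> t \<le> max x (x + w)"
      then have "m = 0 \<or> m = 1 \<or> m = 2" by auto
      then show "(d m has_real_derivative d (Suc m) t) (at t)"
        using hinge_deriv_x hinge_deriv2_x hinge_deriv3_x assms by (auto simp: d_def)
    qed
  qed (use False in \<open>auto simp: d_def\<close>)
  then obtain t where t: "hinge (x + w) v
      = (\<Sum>m<3. (d m x / fact m) * w^m) + (d 3 t / fact 3) * w^3"
    by auto
  define y where "y = t / sqrt v"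
  have "\<bar>d 3 t\<bar> = \<bar>y\<bar> * std_normal_density y / v"
    using assms by (simp add: d_def abs_mult y_def)
  also have "\<dots> \<le> 1 / v"
    using abs_mult_std_normal_density_le_1[of y] assms by (simp add: divide_right_mono)
  finally have "\<bar>d 3 t\<bar> \<le> 1 / v" .
  then have "\<bar>d 3 t / fact 3 * w ^ 3\<bar> \<le> (1 / v) * \<bar>w\<bar> ^ 3"
    unfolding abs_mult power_abs[symmetric]
    by (intro mult_right_mono) (auto simp: fact_numeral abs_divide)
  moreover have "(\<Sum>m<3. (d m x / fact m) * w^m) = hinge x v + Phi (x / sqrt v) * w
     + std_normal_density (x / sqrt v) / (2 * sqrt v) * w\<^sup>2"
    by (simp add: d_def eval_nat_numeral)
  ultimately show ?thesis using t by simp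
qed simp

lemma hinge_taylor_v:
  assumes "v \<ge> 1" "h \<ge> 0"
  shows "\<bar>hinge x (v + h) - hinge x v - std_normal_density (x / sqrt v) / (2 * sqrt v) * h\<bar> \<le> h\<^sup>2 / v"
proof (cases "h = 0")
  case False
  define d where "d = (\<lambda>m::nat. if m = 0 then hinge x
    else if m = 1 then (\<lambda>v. std_normal_density (x / sqrt v) / (2 * sqrt v))
    else (\<lambda>v. ((x / sqrt v)\<^sup>2 - 1) * std_normal_density (x / sqrt v) / (4 * v * sqrt v)))"
  have "\<exists>t. v < t \<and> t < v + h \<and>
      hinge x (v + h) = (\<Sum>m<2. (d m v / fact m) * (v + h - v)^m) + (d 2 t / fact 2) * (v + h - v)^2"
  proof (rule Taylor_up[where a=v])
    show "\<forall>m t. m < 2 \<and> v \<le> t \<and> t \<le> v + h \<longrightarrow>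
        (d m has_real_derivative d (Suc m) t) (at t)"
    proof (intro allI impI)
      fix m :: nat and t assume *: "m < 2 \<and> v \<le> t \<and> t \<le> v + h"
      then have "m = 0 \<or> m = 1" by auto
      then show "(d m has_real_derivative d (Suc m) t) (at t)"
        using hinge_deriv_v[of t x] hinge_deriv2_v[of t x] assms * by (auto simp: d_def)
    qed
  qed (use False assms in \<open>auto simp: d_def\<close>)
  then obtain t where t: "v < t" "hinge x (v + h)
      = (\<Sum>m<2. (d m v / fact m) * h^m) + (d 2 t / fact 2) * h^2"
    by auto
  have "\<bar>((x / sqrt t)\<^sup>2 - 1) * std_normal_density (x / sqrt t)\<bar> \<le> 1"
    using power2_mult_std_normal_density_le_1[of "x / sqrt t"] std_normal_density_le_1[of "x / sqrt t"]
      mult_nonneg_nonneg[OF zero_le_power2[of "x / sqrt t"] normal_density_nonneg[of 0 1 "x / sqrt t"]]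
      normal_density_nonneg[of 0 1 "x / sqrt t"]
    unfolding left_diff_distrib abs_le_iff by linarith
  \<comment> \<open>The natural order \<open>t * sqrt t\<close> is weakened, using
    \<open>sqrt t \<ge> 1\<close>, so that this error has the same denominator as the one in
    \<open>hinge_taylor_x\<close>.\<close>
  moreover have "v \<le> 4 * t * sqrt t"
  proof -
    have "t \<le> t * sqrt t" using mult_left_mono[of 1 "sqrt t" t] t assms by simp
    then show ?thesis using t assms unfolding mult.assoc by linarith
  qed
  ultimately have "\<bar>d 2 t\<bar> \<le> 1 / v"
    unfolding d_def using assms t by (simp add: abs_divide frac_le)
  then have "\<bar>d 2 t / fact 2 * h\<^sup>2\<bar> \<le> (1 / v) * h\<^sup>2"
    unfolding abs_mult abs_power2
    by (intro mult_right_mono) (auto simp: fact_numeral abs_divide)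
  moreover have "(\<Sum>m<2. (d m v / fact m) * h^m) = hinge x v
     + std_normal_density (x / sqrt v) / (2 * sqrt v) * h"
    by (simp add: d_def eval_nat_numeral)
  ultimately show ?thesis using t by simp
qed simp

text \<open>Markov's inequality: on the event that a Gaussian \<open>G\<close> is at most
  \<open>x \<le> 0\<close>, \<open>\<bar>x\<bar>\<close> is at most the absolute value of
  \<open>G\<close>, whose mean is \<open>sqrt (2 / pi)\<close>.\<close>

lemma abs_mult_Phi_le_1:
  assumes "x \<le> 0"
  shows "\<bar>x\<bar> * Phi x \<le> 1"
proof -
  let ?G = "density lborel std_normal_density"
  interpret G: prob_space ?G by (rule prob_space_std_normal)
  have "(\<integral>y. \<bar>y\<bar> \<partial>?G) = sqrt (2 / pi)"
    using integral_std_normal_moment_abs_odd[of 0] by (simp add: integral_density)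
  also have "\<dots> \<le> 1" using pi_gt3 by simp
  finally have 1: "(\<integral>y. \<bar>y\<bar> \<partial>?G) \<le> 1" .
  have int: "integrable ?G (\<lambda>y. \<bar>y\<bar>)"
    using integrable_std_normal_moment_abs[of 1] by (simp add: integrable_density)
  have "\<bar>x\<bar> * Phi x = (\<integral>y. \<bar>x\<bar> * indicator {..x} y \<partial>?G)"
    by (simp add: Phi_def)
  also have "\<dots> \<le> (\<integral>y. \<bar>y\<bar> \<partial>?G)"
    using assms by (intro integral_mono int integrable_mult_right integrable_real_indicator)
      (auto split: split_indicator simp: less_top[symmetric])
  finally show ?thesis using 1 by simp
qed

text \<open>The sum of both values has derivative 0, and its limit at infinity identifies the
  constant.\<close>

lemma Phi_minus: "Phi (- x) = 1 - Phi x"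
proof -
  have "((\<lambda>x. Phi x + Phi (- x)) has_real_derivative 0) (at x)" for x
  proof -
    have "((\<lambda>x. Phi x + Phi (- x)) has_real_derivative
        std_normal_density x + std_normal_density (- x) * (- 1)) (at x)"
      by (intro DERIV_add Phi_has_real_derivative DERIV_chain2[OF Phi_has_real_derivative])
        (auto intro!: derivative_eq_intros)
    then show ?thesis by (simp add: std_normal_density_def)
  qed
  then have const: "Phi x + Phi (- x) = Phi y + Phi (- y)" for x y
    using DERIV_isconst_all by blast
  have "((\<lambda>y. Phi y + Phi (- y)) \<longlongrightarrow> 1 + 0) at_top"
    by (intro tendsto_add Phi_tendsto_1 filterlim_compose[OF Phi_tendsto_0]
        filterlim_uminus_at_bot_at_top)
  moreover have "(\<lambda>y. Phi y + Phi (- y)) = (\<lambda>y. Phi x + Phi (- x))"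
    by (rule ext) (rule const)
  ultimately have "((\<lambda>y::real. Phi x + Phi (- x)) \<longlongrightarrow> 1) at_top" by simp
  then have "Phi x + Phi (- x) = 1" by (simp add: tendsto_const_iff)
  then show ?thesis by simp
qed

text \<open>The price for smoothing the kink by a Gaussian of variance 1 before the exchange
  begins.\<close>

lemma hinge_1_approx: "\<bar>hinge x 1 - max 0 x\<bar> \<le> 1"
proof (cases "x \<le> 0")
  case True
  then show ?thesis
    using abs_mult_Phi_le_1[OF True] std_normal_density_le_1[of x] normal_density_nonneg[of 0 1 x]
      mult_nonneg_nonneg[OF _ Phi_nonneg, of "-x" x]
    by (simp add: hinge_def abs_le_iff) (use normal_density_nonneg[of 0 1 x] in linarith)
next
  case False
  then have "x * Phi x \<le> x" "x \<le> 1 + x * Phi x"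
    using abs_mult_Phi_le_1[of "-x"] mult_left_le[OF Phi_le_1, of x x]
    by (auto simp: Phi_minus algebra_simps)
  moreover have "0 \<le> std_normal_density x" "std_normal_density x \<le> 1"
    using std_normal_density_le_1 by auto
  moreover have "hinge x 1 = std_normal_density x + x * Phi x" "max 0 x = x"
    using False by (auto simp: hinge_def)
  ultimately show ?thesis unfolding abs_le_iff by linarith
qed

text \<open>The Legendre transform of the hinge function produces the Gaussian isoperimetric function.\<close>

lemma hinge_legendre:
  assumes "v > 0" "0 < Phi q" "Phi q < 1"
  shows "sqrt v * fG (Phi q) \<le> hinge y v - y * Phi q"
    and "hinge (sqrt v * q) v - sqrt v * q * Phi q = sqrt v * fG (Phi q)"
proof -
  show eq: "hinge (sqrt v * q) v - sqrt v * q * Phi q = sqrt v * fG (Phi q)"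
    using assms by (simp add: hinge_def fG_Phi)
  let ?g = "\<lambda>y. hinge y v - y * Phi q"
  have d: "(?g has_real_derivative Phi (y / sqrt v) - Phi q) (at y)" for y
    using hinge_deriv_x[OF assms(1)] by (auto intro!: derivative_eq_intros)
  \<comment> \<open>The derivative of \<open>?g\<close> changes sign from minus to plus at
    \<open>sqrt v * q\<close>, which is therefore the global minimum.\<close>
  have "?g (sqrt v * q) \<le> ?g y"
  proof (cases "sqrt v * q \<le> y")
    case True
    show ?thesis
    proof (rule DERIV_nonneg_imp_nondecreasing[OF True])
      fix z assume "sqrt v * q \<le> z"
      then have "q \<le> z / sqrt v" using assms by (simp add: field_simps)
      then have "Phi q \<le> Phi (z / sqrt v)" using Phi_strict_mono by (cases "q = z / sqrt v") (auto simp: less_le)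
      then show "\<exists>D. (?g has_real_derivative D) (at z) \<and> 0 \<le> D" using d[of z] by force
    qed
  next
    case False
    then have "y \<le> sqrt v * q" by simp
    then show ?thesis
    proof (rule DERIV_nonpos_imp_nonincreasing)
      fix z assume "z \<le> sqrt v * q"
      then have "z / sqrt v \<le> q" using assms by (simp add: field_simps)
      then have "Phi (z / sqrt v) \<le> Phi q" using Phi_strict_mono by (cases "q = z / sqrt v") (auto simp: less_le)
      then show "\<exists>D. (?g has_real_derivative D) (at z) \<and> D \<le> 0" using d[of z] by force
    qed
  qed
  then show "sqrt v * fG (Phi q) \<le> hinge y v - y * Phi q" using eq by simp
qed

text \<open>For \<open>\<epsilon> = 0\<close> the optimal \<open>y\<close> is minus infinity. The
  point \<open>- v\<close> replaces it, at bounded cost.\<close>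

lemma hinge_minus_le_1:
  assumes "v \<ge> 1"
  shows "hinge (- v) v \<le> 1"
proof -
  have "hinge (- v) v \<le> sqrt v * std_normal_density (- v / sqrt v)"
    using assms Phi_nonneg by (simp add: hinge_def)
  also have "- v / sqrt v = - sqrt v" using assms by (simp add: real_div_sqrt)
  also have "sqrt v * std_normal_density (- sqrt v) \<le> 1"
    using abs_mult_std_normal_density_le_1[of "- sqrt v"] assms by simp
  finally show ?thesis .
qed

lemma abs_hinge_le:
  assumes "v > 0"
  shows "\<bar>hinge x v\<bar> \<le> sqrt v + \<bar>x\<bar>"
proof -
  have "\<bar>hinge x v\<bar> \<le> \<bar>sqrt v * std_normal_density (x / sqrt v)\<bar> + \<bar>x * Phi (x / sqrt v)\<bar>"
    unfolding hinge_def by (rule abs_triangle_ineq)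
  also have "\<dots> \<le> sqrt v * 1 + \<bar>x\<bar> * 1"
    unfolding abs_mult using assms std_normal_density_le_1 Phi_le_1 Phi_nonneg
    by (intro add_mono mult_left_mono) auto
  finally show ?thesis by simp
qed

lemma borel_measurable_hinge[measurable]: "v > 0 \<Longrightarrow> (\<lambda>x. hinge x v) \<in> borel_measurable borel"
  by (intro borel_measurable_continuous_onI DERIV_continuous_on[OF hinge_deriv_x[THEN has_field_derivative_at_within]])

section \<open>Lindeberg's exchange argument\<close>

lemma prob_space_PiM_const: "prob_space P \<Longrightarrow> prob_space (PiM I (\<lambda>_. P))"
  by (intro prob_space_PiM)

lemma product_sigma_finite_const: "prob_space P \<Longrightarrow> product_sigma_finite (\<lambda>_. P)"
  by (simp add: product_sigma_finite_def prob_space_imp_sigma_finite)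

lemma distr_PiM_component_const:
  assumes "prob_space P" "finite I" "i \<in> I"
  shows "distr (PiM I (\<lambda>_. P)) P (\<lambda>z. z i) = P"
proof (rule measure_eqI)
  interpret product_prob_space "\<lambda>_. P" I
    using assms by (simp add: product_prob_space_def product_sigma_finite_const product_prob_space_axioms_def)
  fix A assume "A \<in> sets (distr (PiM I (\<lambda>_. P)) P (\<lambda>z. z i))"
  then have A: "A \<in> sets P" by simp
  have "emeasure (distr (PiM I (\<lambda>_. P)) P (\<lambda>z. z i)) A
      = emeasure (PiM I (\<lambda>_. P)) {z \<in> space (PiM I (\<lambda>_. P)). z i \<in> A}"
    using A assms by (subst emeasure_distr) (auto intro!: arg_cong2[where f=emeasure])
  also have "\<dots> = emeasure P A"
    by (rule emeasure_PiM_Collect_single) (use A assms in auto)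
  finally show "emeasure (distr (PiM I (\<lambda>_. P)) P (\<lambda>z. z i)) A = emeasure P A" .
qed simp

lemma integrable_PiM_component_const:
  fixes f :: "'z \<Rightarrow> real"
  assumes "prob_space P" "finite I" "i \<in> I" "integrable P f"
  shows "integrable (PiM I (\<lambda>_. P)) (\<lambda>z. f (z i))"
  using integrable_distr[of "\<lambda>z. z i" "PiM I (\<lambda>_. P)" P f] assms
  by (auto simp: distr_PiM_component_const)

lemma integral_PiM_component_const:
  fixes f :: "'z \<Rightarrow> real"
  assumes "prob_space P" "finite I" "i \<in> I" "f \<in> borel_measurable P"
  shows "(\<integral>z. f (z i) \<partial>PiM I (\<lambda>_. P)) = integral\<^sup>L P f"
  using integral_distr[of "\<lambda>z. z i" "PiM I (\<lambda>_. P)" P f] assms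
  by (auto simp: distr_PiM_component_const)

lemma AE_PiM_component_const:
  assumes "prob_space P" "finite I" "i \<in> I" "AE y in P. Q y"
  shows "AE z in PiM I (\<lambda>_. P). Q (z i)"
proof -
  have "AE y in distr (PiM I (\<lambda>_. P)) P (\<lambda>z. z i). Q y"
    using assms(4) by (simp only: distr_PiM_component_const[OF assms(1-3)])
  then show ?thesis
    by (rule AE_distrD[rotated]) (use assms in measurable)
qed

lemma (in prob_space) integrable_power2_of_abs_power3:
  fixes W :: "'a \<Rightarrow> real"
  assumes [measurable]: "W \<in> borel_measurable M" and "integrable M (\<lambda>y. \<bar>W y\<bar> ^ 3)"
  shows "integrable M (\<lambda>y. (W y)\<^sup>2)"
proof (rule Bochner_Integration.integrable_bound)
  show "integrable M (\<lambda>y. 1 + \<bar>W y\<bar> ^ 3)" using assms by auto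
  show "AE y in M. norm ((W y)\<^sup>2) \<le> norm (1 + \<bar>W y\<bar> ^ 3)"
  proof (rule AE_I2)
    fix y
    have "\<bar>W y\<bar> ^ 2 \<le> 1 + \<bar>W y\<bar> ^ 3"
    proof (cases "\<bar>W y\<bar> \<le> 1")
      case True
      then show ?thesis using power_le_one[of "\<bar>W y\<bar>" 2] zero_le_power[of "\<bar>W y\<bar>" 3] by linarith
    next
      case False
      then show ?thesis using power_increasing[of 2 3 "\<bar>W y\<bar>"] by simp
    qed
    then show "norm ((W y)\<^sup>2) \<le> norm (1 + \<bar>W y\<bar> ^ 3)" by simp
  qed
qed simp

lemma harm_le_1_plus_ln:
  assumes "n \<ge> 1"
  shows "harm n \<le> 1 + ln (real n)"
proof -
  have "harm (Suc (n - 1)) - ln (real (Suc (n - 1))) \<le> harm (Suc 0) - ln (real (Suc 0))"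
    by (rule decseqD[OF decseq_harm_diff_ln]) simp
  then show ?thesis using assms by (simp add: harm_Suc harm_expand)
qed

locale centered_third_moment = prob_space P for P :: "'z measure" +
  fixes W :: "'z \<Rightarrow> real"
  assumes W_measurable[measurable]: "W \<in> borel_measurable P"
    and W_integrable: "integrable P W"
    and W_mean: "(\<integral>y. W y \<partial>P) = 0"
    and W_third: "integrable P (\<lambda>y. \<bar>W y\<bar> ^ 3)"
begin

definition "Vw = (\<integral>y. (W y)\<^sup>2 \<partial>P)"
text \<open>The cost of one exchange, up to the factor \<open>1 / v\<close>: the third moment comes
  from \<open>hinge_taylor_x\<close>, the square of the variance from
  \<open>hinge_taylor_v\<close>.\<close>

definition "Kw = (\<integral>y. \<bar>W y\<bar> ^ 3 \<partial>P) + Vw\<^sup>2"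

lemma Vw_nonneg: "0 \<le> Vw" by (simp add: Vw_def)

lemma Kw_nonneg: "0 \<le> Kw" by (simp add: Kw_def)

text \<open>If \<open>Vw = 0\<close>, the denominators in \<open>lindeberg\<close> do not grow, so
  the numerator has to vanish. It does, because \<open>W\<close> is then 0 almost
  everywhere.\<close>

lemma Kw_eq_0: "Vw = 0 \<Longrightarrow> Kw = 0"
proof -
  assume V: "Vw = 0"
  then have "AE y in P. (W y)\<^sup>2 = 0"
    using integral_nonneg_eq_0_iff_AE[OF integrable_power2_of_abs_power3[OF W_measurable W_third]]
    by (simp add: Vw_def)
  then have "(\<integral>y. \<bar>W y\<bar> ^ 3 \<partial>P) = (\<integral>y. 0 \<partial>P)"
    by (intro integral_cong_AE) (auto elim: eventually_mono)
  then show ?thesis using V by (simp add: Kw_def)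
qed

lemma integrable_hinge_shift:
  assumes "v > 0"
  shows "integrable P (\<lambda>y. hinge (s + W y) v)"
proof (rule Bochner_Integration.integrable_bound)
  show "integrable P (\<lambda>y. sqrt v + (\<bar>s\<bar> + \<bar>W y\<bar>))" using W_integrable by auto
  show "(\<lambda>y. hinge (s + W y) v) \<in> borel_measurable P"
    using measurable_compose[OF _ borel_measurable_hinge[OF assms], of "\<lambda>y. s + W y" P] by simp
  show "AE y in P. norm (hinge (s + W y) v) \<le> norm (sqrt v + (\<bar>s\<bar> + \<bar>W y\<bar>))"
  proof (rule AE_I2)
    fix y
    show "norm (hinge (s + W y) v) \<le> norm (sqrt v + (\<bar>s\<bar> + \<bar>W y\<bar>))"
      using abs_hinge_le[OF assms, of "s + W y"] abs_triangle_ineq[of s "W y"] assms by simp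
  qed
qed

text \<open>Averaging the expansion in \<open>x\<close> kills the linear term, as \<open>W\<close>
  has mean 0, and leaves \<open>b * Vw\<close>. The expansion in \<open>v\<close> has the same
  leading term by the heat equation, so only the two remainders contribute.\<close>

lemma lindeberg_step:
  assumes v: "v \<ge> 1"
  shows "\<bar>(\<integral>y. hinge (s + W y) v \<partial>P) - hinge s (v + Vw)\<bar> \<le> Kw / v"
proof -
  define a where "a = Phi (s / sqrt v)"
  define b where "b = std_normal_density (s / sqrt v) / (2 * sqrt v)"
  define R where "R = (\<lambda>y. hinge (s + W y) v - hinge s v - a * W y - b * (W y)\<^sup>2)"
  note ints = integrable_hinge_shift[of v s] integrable_power2_of_abs_power3[OF W_measurable W_third] W_integrable W_third
  have R: "integrable P R"
    unfolding R_def using ints v by (intro Bochner_Integration.integrable_diff integrable_mult_right integrable_const) auto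
  have "(\<integral>y. R y \<partial>P) = (\<integral>y. hinge (s + W y) v \<partial>P) - hinge s v - b * Vw"
    unfolding R_def Vw_def using ints v W_mean by (simp add: prob_space)
  moreover have "\<bar>\<integral>y. R y \<partial>P\<bar> \<le> (\<integral>y. \<bar>W y\<bar> ^ 3 \<partial>P) / v"
  proof -
    have "\<bar>\<integral>y. R y \<partial>P\<bar> \<le> (\<integral>y. \<bar>R y\<bar> \<partial>P)" by (rule integral_abs_bound)
    also have "\<dots> \<le> (\<integral>y. \<bar>W y\<bar> ^ 3 / v \<partial>P)"
      using R W_third v hinge_taylor_x[of v s]
      by (intro integral_mono) (auto simp: R_def a_def b_def)
    finally show ?thesis by simp
  qed
  moreover have "\<bar>hinge s (v + Vw) - hinge s v - b * Vw\<bar> \<le> Vw\<^sup>2 / v"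
    using hinge_taylor_v[OF v Vw_nonneg, of s] by (simp add: b_def)
  moreover have "Kw / v = (\<integral>y. \<bar>W y\<bar> ^ 3 \<partial>P) / v + Vw\<^sup>2 / v"
    by (simp add: Kw_def add_divide_distrib)
  ultimately show ?thesis by linarith
qed

abbreviation "Pw n \<equiv> PiM {..<n::nat} (\<lambda>_. P)"

lemma integrable_sum_W: "integrable (Pw n) (\<lambda>z. \<Sum>i<n. W (z i))"
  using W_integrable by (intro Bochner_Integration.integrable_sum integrable_PiM_component_const prob_space_axioms) auto

lemma integrable_hinge_sum:
  assumes "v > 0"
  shows "integrable (Pw n) (\<lambda>z. hinge (s + (\<Sum>i<n. W (z i))) v)"
proof -
  interpret Q: prob_space "Pw n" by (rule prob_space_PiM_const) (rule prob_space_axioms)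
  show ?thesis
  proof (rule Bochner_Integration.integrable_bound)
    show "integrable (Pw n) (\<lambda>z. sqrt v + (\<bar>s\<bar> + \<bar>\<Sum>i<n. W (z i)\<bar>))" using integrable_sum_W[of n] by auto
    show "(\<lambda>z. hinge (s + (\<Sum>i<n. W (z i))) v) \<in> borel_measurable (Pw n)"
      using measurable_compose[OF _ borel_measurable_hinge[OF assms], of "\<lambda>z. s + (\<Sum>i<n. W (z i))" "Pw n"] by simp
    show "AE z in Pw n. norm (hinge (s + (\<Sum>i<n. W (z i))) v) \<le> norm (sqrt v + (\<bar>s\<bar> + \<bar>\<Sum>i<n. W (z i)\<bar>))"
    proof (rule AE_I2)
      fix z
      show "norm (hinge (s + (\<Sum>i<n. W (z i))) v) \<le> norm (sqrt v + (\<bar>s\<bar> + \<bar>\<Sum>i<n. W (z i)\<bar>))"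
        using abs_hinge_le[OF assms, of "s + (\<Sum>i<n. W (z i))"] abs_triangle_ineq[of s "\<Sum>i<n. W (z i)"] assms
        by simp
    qed
  qed
qed

text \<open>Integrating out the last coordinate turns \<open>hinge\<close> at variance
  \<open>v\<close> into \<open>hinge\<close> at variance \<open>v + Vw\<close>, up to
  \<open>Kw / v\<close>. What is left is the same claim for one variable fewer, hence the induction
  over arbitrary \<open>v\<close>.\<close>

lemma lindeberg:
  assumes "v \<ge> 1"
  shows "\<bar>(\<integral>z. hinge (s + (\<Sum>i<n. W (z i))) v \<partial>Pw n) - hinge s (v + real n * Vw)\<bar>
    \<le> (\<Sum>k<n. Kw / (v + real k * Vw))"
  using assms
proof (induction n arbitrary: v)
  case 0
  have "prob_space (PiM ({} :: nat set) (\<lambda>_. P))" by (rule prob_space_PiM_const) (rule prob_space_axioms)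
  then show ?case by (simp add: prob_space.prob_space)
next
  case (Suc n)
  interpret Q: prob_space "Pw n" by (rule prob_space_PiM_const) (rule prob_space_axioms)
  interpret product_sigma_finite "\<lambda>_. P" by (rule product_sigma_finite_const) (rule prob_space_axioms)
  let ?S = "\<lambda>z. s + (\<Sum>i<n. W (z i))"
  have v: "v > 0" "v + Vw \<ge> 1" using Suc.prems Vw_nonneg by auto
  have "(\<integral>z. hinge (s + (\<Sum>i<Suc n. W (z i))) v \<partial>Pw (Suc n))
      = (\<integral>z. (\<integral>y. hinge (s + (\<Sum>i<Suc n. W ((z(n := y)) i))) v \<partial>P) \<partial>Pw n)"
    using integrable_hinge_sum[OF v(1), of "Suc n" s]
    unfolding lessThan_Suc by (intro product_integral_insert) auto
  also have "\<dots> = (\<integral>z. (\<integral>y. hinge (?S z + W y) v \<partial>P) \<partial>Pw n)"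
    by (simp add: add_ac)
  finally have eq: "(\<integral>z. hinge (s + (\<Sum>i<Suc n. W (z i))) v \<partial>Pw (Suc n)) = \<dots>" .
  \<comment> \<open>The exchange error with all the other coordinates fixed. Its bound is uniform in
    them, so it survives integration.\<close>
  define D where "D = (\<lambda>z. (\<integral>y. hinge (?S z + W y) v \<partial>P) - hinge (?S z) (v + Vw))"
  have D: "\<bar>D z\<bar> \<le> Kw / v" for z
    unfolding D_def by (rule lindeberg_step) (use Suc.prems in simp)
  have ih: "integrable (Pw n) (\<lambda>z. hinge (?S z) (v + Vw))"
    by (rule integrable_hinge_sum) (use v in simp)
  have D_meas: "D \<in> borel_measurable (Pw n)"
  proof -
    have "(\<lambda>(z, y). hinge (?S z + W y) v) \<in> borel_measurable (Pw n \<Otimes>\<^sub>M P)"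
      using measurable_compose[OF _ borel_measurable_hinge[OF v(1)],
          of "\<lambda>(z,y). ?S z + W y" "Pw n \<Otimes>\<^sub>M P"] by (simp add: split_beta')
    then have "(\<lambda>z. \<integral>y. hinge (?S z + W y) v \<partial>P) \<in> borel_measurable (Pw n)"
      by (rule borel_measurable_lebesgue_integral)
    then show ?thesis
      unfolding D_def using borel_measurable_integrable[OF ih] by (intro borel_measurable_diff)
  qed
  have iD: "integrable (Pw n) D"
    by (rule Q.integrable_const_bound[where B="Kw / v"]) (use D D_meas in auto)
  have "\<bar>\<integral>z. D z \<partial>Pw n\<bar> \<le> (\<integral>z. \<bar>D z\<bar> \<partial>Pw n)" by (rule integral_abs_bound)
  also have "\<dots> \<le> (\<integral>z. Kw / v \<partial>Pw n)"
    using iD D by (intro integral_mono) auto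
  finally have 1: "\<bar>\<integral>z. D z \<partial>Pw n\<bar> \<le> Kw / v" by (simp add: Q.prob_space)
  have "(\<integral>z. (\<integral>y. hinge (?S z + W y) v \<partial>P) \<partial>Pw n) = (\<integral>z. D z + hinge (?S z) (v + Vw) \<partial>Pw n)"
    by (simp add: D_def)
  also have "\<dots> = (\<integral>z. D z \<partial>Pw n) + (\<integral>z. hinge (?S z) (v + Vw) \<partial>Pw n)"
    using iD ih by simp
  finally have 2: "(\<integral>z. hinge (s + (\<Sum>i<Suc n. W (z i))) v \<partial>Pw (Suc n)) = \<dots>" using eq by simp
  have 3: "\<bar>(\<integral>z. hinge (?S z) (v + Vw) \<partial>Pw n) - hinge s (v + Vw + real n * Vw)\<bar>
      \<le> (\<Sum>k<n. Kw / (v + Vw + real k * Vw))"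
    by (rule Suc.IH) (rule v)
  have 4: "(\<Sum>k<Suc n. Kw / (v + real k * Vw)) = Kw / v + (\<Sum>k<n. Kw / (v + Vw + real k * Vw))"
    unfolding sum.lessThan_Suc_shift by (simp add: algebra_simps)
  have 5: "v + Vw + real n * Vw = v + real (Suc n) * Vw" by (simp add: algebra_simps)
  show ?case using 1 2 3 4 unfolding 5 by linarith
qed

lemma excess_approx:
  "\<bar>(\<integral>z. max 0 (s + (\<Sum>i<n. W (z i))) \<partial>Pw n) - hinge s (1 + real n * Vw)\<bar>
    \<le> 1 + (\<Sum>k<n. Kw / (1 + real k * Vw))"
proof -
  interpret Q: prob_space "Pw n" by (rule prob_space_PiM_const) (rule prob_space_axioms)
  let ?S = "\<lambda>z. s + (\<Sum>i<n. W (z i))"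
  have i1: "integrable (Pw n) (\<lambda>z. max 0 (?S z))" using integrable_sum_W[of n] by auto
  have i2: "integrable (Pw n) (\<lambda>z. hinge (?S z) 1)" by (rule integrable_hinge_sum) simp
  have "\<bar>(\<integral>z. hinge (?S z) 1 \<partial>Pw n) - (\<integral>z. max 0 (?S z) \<partial>Pw n)\<bar>
      = \<bar>\<integral>z. hinge (?S z) 1 - max 0 (?S z) \<partial>Pw n\<bar>"
    using i1 i2 by simp
  also have "\<dots> \<le> (\<integral>z. \<bar>hinge (?S z) 1 - max 0 (?S z)\<bar> \<partial>Pw n)" by (rule integral_abs_bound)
  also have "\<dots> \<le> (\<integral>z. 1 \<partial>Pw n)"
    using i1 i2 hinge_1_approx by (intro integral_mono) auto
  finally show ?thesis using lindeberg[of 1 n s] by (simp add: Q.prob_space)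
qed

lemma sum_Kw_log_bound:
  obtains C where "C \<ge> 0" "\<And>n. n \<ge> 1 \<Longrightarrow> (\<Sum>k<n. Kw / (1 + real k * Vw)) \<le> C * (1 + ln (real n))"
proof (cases "Vw = 0")
  case True
  then show ?thesis using that[of 0] Kw_eq_0 by simp
next
  case False
  then have V: "Vw > 0" using Vw_nonneg by simp
  \<comment> \<open>Expanding \<open>(1 + 1 / Vw) * (1 + k * Vw)\<close> gives \<open>k + 1\<close>
    plus nonnegative terms.\<close>
  define C where "C = Kw * (1 + 1 / Vw)"
  have C: "C \<ge> 0" using V Kw_nonneg by (simp add: C_def)
  have "(\<Sum>k<n. Kw / (1 + real k * Vw)) \<le> C * (1 + ln (real n))" if "n \<ge> 1" for n
  proof -
    have "Kw / (1 + real k * Vw) \<le> C / (real k + 1)" for k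
    proof -
      have "real k + 1 \<le> (1 + 1 / Vw) * (1 + real k * Vw)"
        using V by (simp add: field_simps)
      then have "Kw * (real k + 1) \<le> Kw * ((1 + 1 / Vw) * (1 + real k * Vw))"
        using Kw_nonneg by (rule mult_left_mono)
      moreover have "1 + real k * Vw > 0" using V by (simp add: add_pos_nonneg)
      ultimately show ?thesis by (simp add: C_def divide_simps mult_ac)
    qed
    then have "(\<Sum>k<n. Kw / (1 + real k * Vw)) \<le> (\<Sum>k<n. C / (real k + 1))"
      by (intro sum_mono)
    also have "\<dots> = C * harm n"
      unfolding harm_def sum_distrib_left
      by (rule sum.reindex_bij_witness[where i="\<lambda>k. k - 1" and j=Suc]) (auto simp: field_simps)
    also have "\<dots> \<le> C * (1 + ln (real n))"
      using harm_le_1_plus_ln[OF that] C by (intro mult_left_mono) auto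
    finally show ?thesis .
  qed
  then show ?thesis using that C by blast
qed

end

section \<open>Ranking codes and the source\<close>

text \<open>Bijective base-2 numerals, least significant digit first, with \<open>True\<close> for
  the digit 2 and \<open>False\<close> for 1. Every string is a numeral, and 0 is the empty one, so
  no string is wasted.\<close>

fun bits :: "nat \<Rightarrow> bool list" where
  "bits r = (if r = 0 then [] else even r # bits ((r - 1) div 2))"

fun unbits :: "bool list \<Rightarrow> nat" where
  "unbits [] = 0"
| "unbits (b # bs) = 2 * unbits bs + (if b then 2 else 1)"

declare bits.simps[simp del]

lemma unbits_bits: "unbits (bits r) = r"
proof (induction r rule: bits.induct)
  case (1 r)
  show ?case
  proof (cases "r = 0")
    case False
    with 1 have "unbits (bits r) = 2 * ((r - 1) div 2) + (if even r then 2 else 1)"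
      by (subst bits.simps) simp
    also have "\<dots> = r" using False by (cases "even r") (auto elim!: evenE oddE)
    finally show ?thesis .
  qed (simp add: bits.simps)
qed

lemma length_bits: "2 ^ length (bits r) \<le> r + 1"
proof (induction r rule: bits.induct)
  case (1 r)
  show ?case
  proof (cases "r = 0")
    case False
    with 1 have "2 ^ length (bits r) \<le> 2 * ((r - 1) div 2 + 1)"
      by (subst bits.simps) simp
    also have "\<dots> \<le> r + 1" using False by simp
    finally show ?thesis .
  qed (simp add: bits.simps)
qed

text \<open>Given the side information \<open>y\<close>, the \<open>j\<close>-th source value is encoded by its rank in the order of
  decreasing probability, ties being broken by the index.\<close>

definition better :: "(nat \<Rightarrow> 'y \<Rightarrow> real) \<Rightarrow> nat \<Rightarrow> 'y \<Rightarrow> nat set" where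
  "better Q j y = {j'. Q j y < Q j' y \<or> (Q j' y = Q j y \<and> j' < j)}"

text \<open>Since the total mass is at most 1, at most \<open>1 / Q j y\<close> values are as
  probable as \<open>j\<close>, which bounds the rank of \<open>j\<close>. No prefix condition is
  imposed, so the length is the logarithm of the rank without overhead.\<close>

lemma ranking_code:
  fixes Q :: "nat \<Rightarrow> 'y \<Rightarrow> real"
  assumes meas[measurable]: "\<And>j. Q j \<in> borel_measurable N"
    and nonneg: "\<And>j y. 0 \<le> Q j y"
    and sum_le: "\<And>B y. finite B \<Longrightarrow> (\<Sum>j\<in>B. Q j y) \<le> 1"
  obtains enc dec where
    "\<And>j. enc j \<in> N \<rightarrow>\<^sub>M (count_space UNIV :: bool list measure)"
    "\<And>b. dec b \<in> N \<rightarrow>\<^sub>M (count_space UNIV :: nat measure)"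
    "\<And>j y. 0 < Q j y \<Longrightarrow> dec (enc j y) y = j"
    "\<And>j y. 0 < Q j y \<Longrightarrow> real (length (enc j y)) \<le> log 2 (1 / Q j y)"
proof -
  define rank where "rank = (\<lambda>j y. card (better Q j y))"
  have rank_meas[measurable]: "rank j \<in> N \<rightarrow>\<^sub>M count_space UNIV" for j
    unfolding rank_def better_def by measurable
  have fin: "finite (insert j (better Q j y))"
    "real (card (insert j (better Q j y))) \<le> 1 / Q j y" if pos: "0 < Q j y" for j y
  proof -
    have "real (card G) \<le> 1 / Q j y" if G: "G \<subseteq> insert j (better Q j y)" "finite G" for G
    proof -
      have "real (card G) * Q j y = (\<Sum>j'\<in>G. Q j y)" by simp
      also have "\<dots> \<le> (\<Sum>j'\<in>G. Q j' y)"
        using G by (intro sum_mono) (auto simp: better_def)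
      also have "\<dots> \<le> 1" by (rule sum_le) fact
      finally show ?thesis using pos by (simp add: field_simps)
    qed
    \<comment> \<open>Whether \<open>better\<close> is finite is not known in advance, and
      \<open>card\<close> of an infinite set is 0. The counting bound is therefore stated for finite
      subsets, and yields finiteness along with the bound.\<close>
    then have "card G \<le> nat \<lfloor>1 / Q j y\<rfloor>" if "G \<subseteq> insert j (better Q j y)" "finite G" for G
      using that by (simp add: le_nat_floor)
    then have *: "finite (insert j (better Q j y)) \<and> card (insert j (better Q j y)) \<le> nat \<lfloor>1 / Q j y\<rfloor>"
      by (rule finite_if_finite_subsets_card_bdd)
    from * show "finite (insert j (better Q j y))" by (rule conjunct1)
    then show "real (card (insert j (better Q j y))) \<le> 1 / Q j y"
      using \<open>\<And>G. G \<subseteq> insert j (better Q j y) \<Longrightarrow> finite G \<Longrightarrow> real (card G) \<le> 1 / Q j y\<close> by blast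
  qed
  have self: "j \<notin> better Q j y" for j y by (simp add: better_def)
  have less: "rank j' y < rank j y" if "j' \<in> better Q j y" "0 < Q j y" for j j' y
  proof -
    have "better Q j' y \<subset> better Q j y"
      using that by (auto simp: better_def)
    then show ?thesis
      unfolding rank_def using fin(1)[OF that(2)] by (intro psubset_card_mono) auto
  qed
  have inj: "j = j'" if "0 < Q j y" "0 < Q j' y" "rank j y = rank j' y" for j j' y
  proof (rule ccontr)
    assume "j \<noteq> j'"
    then have "j' \<in> better Q j y \<or> j \<in> better Q j' y" by (auto simp: better_def)
    then show False using less that by (metis less_irrefl)
  qed
  define enc where "enc = (\<lambda>j y. bits (rank j y))"
  \<comment> \<open>The positivity guard is essential: a value of probability 0 can have infinitely
    many better ones, whence rank 0 by the convention on \<open>card\<close>, and would collide with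
    the most probable value.\<close>
  define dec where "dec = (\<lambda>b y. LEAST j. 0 < Q j y \<and> rank j y = unbits b)"
  show ?thesis
  proof
    show "enc j \<in> N \<rightarrow>\<^sub>M count_space UNIV" for j
      unfolding enc_def by (rule measurable_compose[OF rank_meas]) simp
    show "dec b \<in> N \<rightarrow>\<^sub>M count_space UNIV" for b
      unfolding dec_def by measurable
    show "dec (enc j y) y = j" if "0 < Q j y" for j y
      unfolding dec_def enc_def unbits_bits
      by (rule Least_equality) (use that inj in auto)
    show "real (length (enc j y)) \<le> log 2 (1 / Q j y)" if pos: "0 < Q j y" for j y
    proof -
      \<comment> \<open>Ranks start at 0, so adding 1 accounts for \<open>j\<close> itself. This is
        the same offset as in \<open>length_bits\<close>, and no constant is lost.\<close>
      have "rank j y + 1 = card (insert j (better Q j y))"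
        using fin(1)[OF pos] self by (simp add: rank_def)
      then have "real (rank j y + 1) \<le> 1 / Q j y" using fin(2)[OF pos] by simp
      moreover have "real (2 ^ length (enc j y)) \<le> real (rank j y + 1)"
        unfolding enc_def by (rule of_nat_mono) (rule length_bits)
      ultimately have "2 powr real (length (enc j y)) \<le> 1 / Q j y"
        by (simp add: powr_realpow)
      then show ?thesis using pos by (simp add: le_log_iff)
    qed
  qed
qed

text \<open>Serves the converse: once the law of the encoder is written as point masses, each can be
  bounded by 1, which leaves the counting measure.\<close>

lemma nn_integral_countable_singletons:
  fixes E :: "'b::countable measure"
  assumes "sets E = UNIV"
  shows "(\<integral>\<^sup>+b. f b \<partial>E) = (\<integral>\<^sup>+b. emeasure E {b} * f b \<partial>count_space UNIV)"
proof -
  have "E = density (count_space UNIV) (\<lambda>b. emeasure E {b})"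
  proof (rule measure_eqI)
    fix A assume "A \<in> sets E"
    show "emeasure E A = emeasure (density (count_space UNIV) (\<lambda>b. emeasure E {b})) A"
      using assms
      by (subst emeasure_countable_singleton)
        (auto simp: emeasure_density nn_integral_count_space_indicator mult.commute
          intro!: nn_integral_cong)
  qed (use assms in simp)
  then have "(\<integral>\<^sup>+b. f b \<partial>E) = (\<integral>\<^sup>+b. f b \<partial>density (count_space UNIV) (\<lambda>b. emeasure E {b}))"
    by simp
  also have "\<dots> = (\<integral>\<^sup>+b. emeasure E {b} * f b \<partial>count_space UNIV)"
    by (rule nn_integral_density) auto
  finally show ?thesis .
qed

lemma nn_integral_length:
  "(\<integral>\<^sup>+b. f (length b) \<partial>count_space (UNIV :: bool list set)) = (\<Sum>l. 2 ^ l * f l)"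
proof -
  have "(\<integral>\<^sup>+b. f (length b) \<partial>count_space (UNIV :: bool list set))
      = (\<integral>\<^sup>+b. (\<Sum>l. f l * indicator {b. length b = l} b) \<partial>count_space (UNIV :: bool list set))"
  proof (rule nn_integral_cong)
    fix b :: "bool list"
    have "(\<Sum>l. f l * indicator {b. length b = l} b) = (\<Sum>l\<in>{length b}. f l * indicator {b. length b = l} b)"
      by (rule suminf_finite) auto
    then show "f (length b) = (\<Sum>l. f l * indicator {b. length b = l} b)" by simp
  qed
  also have "\<dots> = (\<Sum>l. \<integral>\<^sup>+b. f l * indicator {b. length b = l} b \<partial>count_space (UNIV :: bool list set))"
    by (rule nn_integral_suminf) simp
  also have "\<dots> = (\<Sum>l. 2 ^ l * f l)"
  proof (rule suminf_cong)
    fix l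
    have "finite {b::bool list. length b = l}" "card {b::bool list. length b = l} = 2 ^ l"
      using finite_lists_length_eq[of "UNIV::bool set" l] card_lists_length_eq[of "UNIV::bool set" l] by auto
    then show "(\<integral>\<^sup>+b. f l * indicator {b. length b = l} b \<partial>count_space (UNIV :: bool list set)) = 2 ^ l * f l"
      by (simp add: nn_integral_cmult_indicator mult.commute)
  qed
  finally show ?thesis .
qed

text \<open>\<open>P\<close> is the joint law of one pair and \<open>\<mu>\<close> the law of the
  side information. The conditions on \<open>q\<close> are imposed for every \<open>y\<close>,
  because the ranking code sorts and counts for each \<open>y\<close> separately.
  \<open>P_rect\<close> states that \<open>q\<close> is a conditional law.\<close>

locale cond_source =
  fixes N :: "'b measure" and \<mu> :: "'b measure" and P :: "(nat \<times> 'b) measure"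
    and q :: "nat \<Rightarrow> 'b \<Rightarrow> real"
  assumes prob_\<mu>: "prob_space \<mu>" and sets_\<mu>[measurable_cong]: "sets \<mu> = sets N"
    and prob_P: "prob_space P" and sets_P[measurable_cong]: "sets P = sets (count_space UNIV \<Otimes>\<^sub>M N)"
    and q_measurable[measurable]: "\<And>x. q x \<in> borel_measurable N"
    and q_nonneg: "\<And>x y. 0 \<le> q x y"
    and q_sum: "\<And>m y. (\<Sum>x<m. q x y) \<le> 1"
    and P_rect: "\<And>x A. A \<in> sets N \<Longrightarrow> emeasure P ({x} \<times> A) = (\<integral>\<^sup>+y\<in>A. ennreal (q x y) \<partial>\<mu>)"
begin

lemma q_le_1: "q x y \<le> 1"
proof -
  have "q x y \<le> (\<Sum>x<Suc x. q x y)" using q_nonneg by (simp add: sum_nonneg)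
  then show ?thesis using q_sum[of y "Suc x"] by linarith
qed

definition info :: "nat \<times> 'b \<Rightarrow> real" where "info z = log 2 (1 / q (fst z) (snd z))"

lemma info_nonneg: "0 \<le> info z"
proof (cases "q (fst z) (snd z) = 0")
  case False
  then show ?thesis
    using q_nonneg[of "fst z" "snd z"] q_le_1[of "fst z" "snd z"]
    by (auto simp: info_def zero_le_log_cancel_iff)
\<comment> \<open>At \<open>q = 0\<close> the conventions for division by 0 and for the logarithm of
  0 give the value 0, so nonnegativity holds everywhere.\<close>
qed (simp add: info_def log_def)

lemma q_joint_measurable[measurable]: "(\<lambda>z. q (fst z) (snd z)) \<in> borel_measurable (count_space UNIV \<Otimes>\<^sub>M N)"
  by (rule measurable_compose_countable[where g=fst]) measurable

lemma info_measurable[measurable]: "info \<in> borel_measurable (count_space UNIV \<Otimes>\<^sub>M N)"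
  unfolding info_def by measurable

definition qn :: "nat \<Rightarrow> (nat \<Rightarrow> nat) \<Rightarrow> (nat \<Rightarrow> 'b) \<Rightarrow> real" where
  "qn n x y = (\<Prod>i<n. q (x i) (y i))"

lemma qn_nonneg: "0 \<le> qn n x y" by (simp add: qn_def prod_nonneg q_nonneg)

lemma qn_measurable[measurable]: "qn n x \<in> borel_measurable (PiM {..<n} (\<lambda>_. N))"
  unfolding qn_def by measurable

abbreviation "words n \<equiv> PiE {..<n::nat} (\<lambda>_. UNIV :: nat set)"

lemma countable_words: "countable (words n)"
  by (intro countable_PiE) auto

text \<open>A finite set of words fits into a cube, over which the sum of products
  factorizes.\<close>

lemma qn_sum_le_1:
  assumes "finite F" "F \<subseteq> words n"
  shows "(\<Sum>x\<in>F. qn n x y) \<le> 1"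
proof -
  define m where "m = Suc (Max ((\<lambda>(x, i). x i) ` (F \<times> {..<n})))"
  have "x i < m" if "x \<in> F" "i < n" for x i
  proof -
    have "x i \<le> Max ((\<lambda>(x, i). x i) ` (F \<times> {..<n}))"
      using that assms(1) by (intro Max_ge) auto
    then show ?thesis by (simp add: m_def)
  qed
  then have "F \<subseteq> PiE {..<n} (\<lambda>_. {..<m})"
    using assms(2) by (auto simp: PiE_iff)
  then have "(\<Sum>x\<in>F. qn n x y) \<le> (\<Sum>x\<in>PiE {..<n} (\<lambda>_. {..<m}). qn n x y)"
    by (intro sum_mono2 finite_PiE) (auto simp: qn_nonneg)
  also have "\<dots> = (\<Prod>i<n. \<Sum>a<m. q a (y i))"
    unfolding qn_def by (rule prod_sum_PiE[symmetric]) auto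
  also have "\<dots> \<le> 1"
    by (intro prod_le_1) (auto simp: sum_nonneg q_nonneg q_sum)
  finally show ?thesis .
qed

abbreviation "Pw n \<equiv> PiM {..<n::nat} (\<lambda>_. P)"
abbreviation "Yn n \<equiv> PiM {..<n::nat} (\<lambda>_. N)"
abbreviation "Xn n \<equiv> PiM {..<n::nat} (\<lambda>_. count_space (UNIV :: nat set))"

lemma space_Pw: "space (Pw n) = PiE {..<n} (\<lambda>_. UNIV \<times> space N)"
  using sets_eq_imp_space_eq[OF sets_P] by (simp add: space_PiM space_pair_measure)

lemma ys_of_measurable[measurable]: "ys_of n \<in> Pw n \<rightarrow>\<^sub>M Yn n"
  unfolding ys_of_def by measurable

lemma xs_of_words: "xs_of n z \<in> words n"
  by (auto simp: xs_of_def)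

text \<open>The target is discrete and countable, so a function of both words is measurable as soon
  as it is for each fixed source word.\<close>

lemma xs_of_measurable[measurable]: "xs_of n \<in> Pw n \<rightarrow>\<^sub>M count_space (words n)"
  unfolding measurable_count_space_eq_countable[OF countable_words]
proof (intro conjI ballI funcsetI xs_of_words)
  fix x assume x: "x \<in> words n"
  have "xs_of n -` {x} \<inter> space (Pw n) = {z \<in> space (Pw n). \<forall>i<n. fst (z i) = x i}"
    using x by (auto simp: xs_of_def fun_eq_iff PiE_iff extensional_def)
  also have "\<dots> \<in> sets (Pw n)" by measurable
  finally show "xs_of n -` {x} \<inter> space (Pw n) \<in> sets (Pw n)" .
qed

text \<open>Both sides are the integral of \<open>g\<close> with respect to the product of the measures with
  densities \<open>q (x i)\<close>.\<close>

lemma nn_integral_xs_fixed: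
  assumes x: "x \<in> words n" and g[measurable]: "g \<in> borel_measurable (Yn n)"
  shows "(\<integral>\<^sup>+z. g (ys_of n z) * indicator {z. xs_of n z = x} z \<partial>Pw n)
    = (\<integral>\<^sup>+y. ennreal (qn n x y) * g y \<partial>PiM {..<n} (\<lambda>_. \<mu>))"
proof -
  define D where "D = (\<lambda>i. density \<mu> (\<lambda>y. ennreal (q (x i) y)))"
  \<comment> \<open>The law of the side information restricted to the event that the source word is
    \<open>x\<close>. \<open>A\<close> and \<open>B\<close> are both identified with the product of
    the \<open>D i\<close> on boxes.\<close>
  define A where "A = distr (density (Pw n) (indicator {z \<in> space (Pw n). xs_of n z = x})) (Yn n) (ys_of n)"
  define B where "B = density (PiM {..<n} (\<lambda>_. \<mu>)) (\<lambda>y. ennreal (qn n x y))"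
  interpret \<mu>: prob_space \<mu> by (rule prob_\<mu>)
  interpret P: prob_space P by (rule prob_P)
  have D_emb: "emeasure (D i) S = emeasure P ({x i} \<times> S)" if "S \<in> sets N" for i S
    unfolding D_def using that sets_\<mu> by (subst emeasure_density) (auto simp: P_rect)
  have D_fin: "finite_measure (D i)" for i
  proof
    have "emeasure (D i) (space (D i)) = emeasure P ({x i} \<times> space N)"
      using D_emb[of "space N" i] sets_eq_imp_space_eq[OF sets_\<mu>] by (simp add: D_def)
    then show "emeasure (D i) (space (D i)) \<noteq> \<infinity>" by simp
  qed
  interpret D: product_sigma_finite D
    unfolding product_sigma_finite_def using D_fin by (auto simp: finite_measure_def)
  interpret mu: product_sigma_finite "\<lambda>_. \<mu>"
    by (simp add: product_sigma_finite_def \<mu>.sigma_finite_measure_axioms)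
  interpret PP: product_sigma_finite "\<lambda>_. P"
    by (simp add: product_sigma_finite_def P.sigma_finite_measure_axioms)
  have sets_D: "sets (PiM {..<n} D) = sets (Yn n)"
    by (intro sets_PiM_cong) (auto simp: D_def sets_\<mu>)
  have mS[measurable]: "{z \<in> space (Pw n). xs_of n z = x} \<in> sets (Pw n)"
    using measurable_sets[OF xs_of_measurable, of "{x}" n] x
    by (simp add: vimage_def Int_def conj_commute)
  have "A = PiM {..<n} D"
  proof (rule D.PiM_eqI)
    show "sets A = sets (PiM {..<n} D)" by (simp add: A_def sets_D)
    fix S assume "\<And>i. i \<in> {..<n} \<Longrightarrow> S i \<in> sets (D i)"
    then have S: "\<And>i. i < n \<Longrightarrow> S i \<in> sets N" by (simp add: D_def sets_\<mu>)
    then have S': "\<And>i. i < n \<Longrightarrow> S i \<subseteq> space N" using sets.sets_into_space by blast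
    have PiS: "PiE {..<n} S \<in> sets (Yn n)" using S by (intro sets_PiM_I_finite) auto
    have "emeasure A (PiE {..<n} S)
        = emeasure (Pw n) ({z \<in> space (Pw n). xs_of n z = x} \<inter> (ys_of n -` PiE {..<n} S \<inter> space (Pw n)))"
      unfolding A_def using PiS
      by (subst emeasure_distr) (auto simp: emeasure_density indicator_inter_arith[symmetric] nn_integral_indicator
        measurable_sets[OF ys_of_measurable PiS])
    also have "{z \<in> space (Pw n). xs_of n z = x} \<inter> (ys_of n -` PiE {..<n} S \<inter> space (Pw n))
        = PiE {..<n} (\<lambda>i. {x i} \<times> S i)"
    proof (intro set_eqI iffI)
      fix z assume "z \<in> {z \<in> space (Pw n). xs_of n z = x} \<inter> (ys_of n -` PiE {..<n} S \<inter> space (Pw n))"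
      then have z: "z \<in> space (Pw n)" "xs_of n z = x" "ys_of n z \<in> PiE {..<n} S" by auto
      have "z i \<in> {x i} \<times> S i" if "i < n" for i
        using fun_cong[OF z(2), of i] PiE_mem[OF z(3), of i] that
        by (cases "z i") (auto simp: xs_of_def ys_of_def)
      then show "z \<in> PiE {..<n} (\<lambda>i. {x i} \<times> S i)"
        using z(1) by (auto simp: space_Pw PiE_iff)
    next
      fix z assume z: "z \<in> PiE {..<n} (\<lambda>i. {x i} \<times> S i)"
      have zi: "fst (z i) = x i" "snd (z i) \<in> S i" if "i < n" for i
        using PiE_mem[OF z, of i] that by (auto simp: mem_Times_iff)
      have "xs_of n z = x" using x zi by (auto simp: xs_of_def fun_eq_iff PiE_iff extensional_def)
      moreover have "ys_of n z \<in> PiE {..<n} S" using zi by (auto simp: ys_of_def)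
      moreover have "z \<in> space (Pw n)" using z S' zi
        by (auto simp: space_Pw PiE_iff mem_Times_iff)
      ultimately show "z \<in> {z \<in> space (Pw n). xs_of n z = x} \<inter> (ys_of n -` PiE {..<n} S \<inter> space (Pw n))"
        by auto
    qed
    also have "emeasure (Pw n) (PiE {..<n} (\<lambda>i. {x i} \<times> S i)) = (\<Prod>i<n. emeasure P ({x i} \<times> S i))"
      using S by (intro PP.emeasure_PiM) (auto simp: sets_P)
    also have "\<dots> = (\<Prod>i<n. emeasure (D i) (S i))"
      using S by (intro prod.cong) (auto simp: D_emb)
    finally show "emeasure A (PiE {..<n} S) = (\<Prod>i<n. emeasure (D i) (S i))" .
  qed simp
  moreover have "B = PiM {..<n} D"
  proof (rule D.PiM_eqI)
    show "sets B = sets (PiM {..<n} D)"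
      by (simp add: B_def sets_D) (intro sets_PiM_cong, auto simp: sets_\<mu>)
    fix S assume "\<And>i. i \<in> {..<n} \<Longrightarrow> S i \<in> sets (D i)"
    then have S[measurable]: "\<And>i. i < n \<Longrightarrow> S i \<in> sets N" by (simp add: D_def sets_\<mu>)
    have "emeasure B (PiE {..<n} S)
        = (\<integral>\<^sup>+y. ennreal (qn n x y) * indicator (PiE {..<n} S) y \<partial>PiM {..<n} (\<lambda>_. \<mu>))"
      unfolding B_def using S by (subst emeasure_density) (auto simp: sets_\<mu> intro!: sets_PiM_I_finite)
    also have "\<dots> = (\<integral>\<^sup>+y. (\<Prod>i<n. ennreal (q (x i) (y i)) * indicator (S i) (y i)) \<partial>PiM {..<n} (\<lambda>_. \<mu>))"
    proof (rule nn_integral_cong)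
      fix y assume "y \<in> space (PiM {..<n} (\<lambda>_. \<mu>))"
      then have "indicator (PiE {..<n} S) y = (\<Prod>i<n. indicator (S i) (y i) :: ennreal)"
        by (auto simp: space_PiM PiE_iff indicator_def)
      then show "ennreal (qn n x y) * indicator (PiE {..<n} S) y
          = (\<Prod>i<n. ennreal (q (x i) (y i)) * indicator (S i) (y i))"
        by (simp add: qn_def prod_ennreal[symmetric] q_nonneg prod.distrib)
    qed
    also have "\<dots> = (\<Prod>i<n. \<integral>\<^sup>+y. ennreal (q (x i) y) * indicator (S i) y \<partial>\<mu>)"
      by (rule mu.product_nn_integral_prod) (use S in auto)
    also have "\<dots> = (\<Prod>i<n. emeasure (D i) (S i))"
      using S by (intro prod.cong) (auto simp: D_emb P_rect)
    finally show "emeasure B (PiE {..<n} S) = (\<Prod>i<n. emeasure (D i) (S i))" .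
  qed simp
  ultimately have AB: "A = B" by simp
  have "(\<integral>\<^sup>+z. g (ys_of n z) * indicator {z. xs_of n z = x} z \<partial>Pw n)
      = (\<integral>\<^sup>+z. indicator {z \<in> space (Pw n). xs_of n z = x} z * g (ys_of n z) \<partial>Pw n)"
    by (intro nn_integral_cong) (auto split: split_indicator)
  also have "\<dots> = (\<integral>\<^sup>+y. g y \<partial>A)"
    unfolding A_def by (subst nn_integral_distr) (auto simp: nn_integral_density)
  also have "\<dots> = (\<integral>\<^sup>+y. ennreal (qn n x y) * g y \<partial>PiM {..<n} (\<lambda>_. \<mu>))"
    unfolding AB B_def by (rule nn_integral_density) auto
  finally show ?thesis .
qed

end

section \<open>One-shot bounds for codes\<close>

text \<open>The weights \<open>2 powr - length b\<close> are not summable; the factor \<open>1 + 1 / n\<close> makes them so, with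
  total mass of order \<open>n\<close>.\<close>

lemma geometric_length_weight:
  fixes n :: nat
  assumes "n \<ge> 1"
  shows "(\<integral>\<^sup>+b. ennreal (2 powr (- (1 + 1 / real n) * real (length b)) / (4 * real n))
    \<partial>count_space (UNIV :: bool list set)) \<le> 1"
proof -
  define x where "x = 1 / real n"
  have x: "0 < x" "x \<le> 1" using assms by (auto simp: x_def)
  define r where "r = 2 powr (- x)"
  \<comment> \<open>The bound \<open>ln 2 \<ge> 1 / 2\<close> suffices here. It leads to
    \<open>r \<le> 1 - x / 4\<close>, so the geometric series is at most
    \<open>4 / x = 4 * n\<close>, the normalization in the statement.\<close>
  have "1 + x / 2 \<le> 1 + x * ln 2" using ln2_ge_two_thirds x by simp
  also have "\<dots> \<le> exp (x * ln 2)" by (rule exp_ge_add_one_self)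
  finally have "1 + x / 2 \<le> 2 powr x" by (simp add: powr_def)
  then have "r \<le> 1 / (1 + x / 2)"
    unfolding r_def powr_minus using x by (simp add: field_simps)
  also have "\<dots> \<le> 1 - x / 4" using x by (simp add: field_simps power2_eq_square)
  finally have r: "x / 4 \<le> 1 - r" by simp
  have r01: "0 < r" "r < 1" using r x by (auto simp: r_def)
  have "(\<integral>\<^sup>+b. ennreal (2 powr (- (1 + 1 / real n) * real (length b)) / (4 * real n))
      \<partial>count_space (UNIV :: bool list set))
      = (\<Sum>l. 2 ^ l * ennreal (2 powr (- (1 + x) * real l) / (4 * real n)))"
    unfolding x_def by (rule nn_integral_length)
  also have "\<dots> = (\<Sum>l. ennreal (r ^ l * (x / 4)))"
  proof (rule suminf_cong)
    fix l
    have "r ^ l = 2 powr (- x * real l)"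
      using powr_realpow[OF r01(1), of l] by (simp add: r_def powr_powr)
    then have "2 ^ l * (2 powr (- (1 + x) * real l) / (4 * real n)) = r ^ l * (x / 4)"
      by (simp add: x_def powr_realpow[symmetric] powr_add[symmetric] algebra_simps)
    then show "2 ^ l * ennreal (2 powr (- (1 + x) * real l) / (4 * real n)) = ennreal (r ^ l * (x / 4))"
      by (metis ennreal_mult' ennreal_numeral ennreal_power zero_le_numeral zero_le_power)
  qed
  also have "\<dots> = ennreal (\<Sum>l. r ^ l * (x / 4))"
    using r01 x by (intro suminf_ennreal2 summable_mult2 summable_geometric) auto
  also have "(\<Sum>l. r ^ l * (x / 4)) = 1 / (1 - r) * (x / 4)"
    using r01 by (subst suminf_mult2[symmetric]) (auto simp: suminf_geometric)
  finally have eq: "(\<integral>\<^sup>+b. ennreal (2 powr (- (1 + 1 / real n) * real (length b)) / (4 * real n))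
      \<partial>count_space (UNIV :: bool list set)) = ennreal (1 / (1 - r) * (x / 4))" .
  have "1 / (1 - r) * (x / 4) \<le> 1" using r r01 by (simp add: field_simps)
  then show ?thesis unfolding eq by (simp only: ennreal_le_1)
qed

context cond_source
begin

text \<open>For each \<open>x\<close>, the mass of the zero set of \<open>q x\<close> is the
  integral of \<open>q x\<close> over that set, hence 0, and there are countably many
  \<open>x\<close>.\<close>

lemma AE_q_pos: "AE z in P. 0 < q (fst z) (snd z)"
proof -
  have [measurable]: "{y \<in> space N. q x y = 0} \<in> sets N" for x by measurable
  have "{x} \<times> {y \<in> space N. q x y = 0} \<in> null_sets P" for x
  proof (rule null_setsI)
    have "(\<integral>\<^sup>+y\<in>{y \<in> space N. q x y = 0}. ennreal (q x y) \<partial>\<mu>) = (\<integral>\<^sup>+y. 0 \<partial>\<mu>)"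
      by (rule nn_integral_cong) (auto split: split_indicator)
    then show "emeasure P ({x} \<times> {y \<in> space N. q x y = 0}) = 0" by (subst P_rect) auto
  qed (simp add: sets_P)
  then have "(\<Union>x. {x} \<times> {y \<in> space N. q x y = 0}) \<in> null_sets P"
    by (intro null_sets_UN) auto
  then show ?thesis
  proof (rule AE_I')
    show "{z \<in> space P. \<not> 0 < q (fst z) (snd z)} \<subseteq> (\<Union>x. {x} \<times> {y \<in> space N. q x y = 0})"
      using sets_eq_imp_space_eq[OF sets_P] q_nonneg
      by (auto simp: space_pair_measure not_less order_antisym[OF _ q_nonneg])
  qed
qed

definition total_info :: "nat \<Rightarrow> (nat \<Rightarrow> nat \<times> 'b) \<Rightarrow> real" where
  "total_info n z = (\<Sum>i<n. info (z i))"

lemma total_info_nonneg: "0 \<le> total_info n z"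
  by (simp add: total_info_def sum_nonneg info_nonneg)

lemma total_info_measurable[measurable]: "total_info n \<in> borel_measurable (Pw n)"
  unfolding total_info_def by measurable

definition like :: "nat \<Rightarrow> (nat \<Rightarrow> nat \<times> 'b) \<Rightarrow> real" where
  "like n z = qn n (xs_of n z) (ys_of n z)"

lemma like_measurable[measurable]: "like n \<in> borel_measurable (Pw n)"
  unfolding like_def
  by (rule measurable_compose_countable'[OF _ xs_of_measurable countable_words]) measurable

lemma AE_like: "AE z in Pw n. 0 < like n z \<and> log 2 (1 / like n z) = total_info n z"
proof -
  have "AE z in Pw n. \<forall>i\<in>{..<n}. 0 < q (fst (z i)) (snd (z i))"
    by (rule AE_finite_allI) (auto intro!: AE_PiM_component_const[where Q="\<lambda>y. 0 < q (fst y) (snd y)"] prob_P AE_q_pos)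
  then show ?thesis
  proof eventually_elim
    case (elim z)
    have like: "like n z = (\<Prod>i<n. q (fst (z i)) (snd (z i)))"
      by (simp add: like_def qn_def xs_of_def ys_of_def)
    have pos: "0 < q (fst (z i)) (snd (z i))" if "i < n" for i using elim that by auto
    then have pos0: "q (fst (z i)) (snd (z i)) \<noteq> 0" if "i < n" for i using that by fastforce
    have "0 < like n z" unfolding like using pos by (auto intro: prod_pos)
    moreover have "ln (like n z) = (\<Sum>i<n. ln (q (fst (z i)) (snd (z i))))"
      unfolding like using pos by (intro ln_prod) (auto simp: pos0)
    moreover have "total_info n z = (\<Sum>i<n. - ln (q (fst (z i)) (snd (z i))) / ln 2)"
      unfolding total_info_def info_def using pos by (intro sum.cong) (auto simp: log_def ln_div)
    ultimately have "log 2 (1 / like n z) = total_info n z"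
      using \<open>0 < like n z\<close> by (simp add: log_def ln_div sum_divide_distrib sum_negf)
    with \<open>0 < like n z\<close> show ?case ..
  qed
qed

section \<open>Stochastic codes and achievability\<close>

definition code ::
  "nat \<Rightarrow> real \<Rightarrow> real \<Rightarrow> ((nat \<Rightarrow> nat \<times> 'b) \<Rightarrow> bool list measure) \<Rightarrow>
   (bool list \<times> (nat \<Rightarrow> 'b) \<Rightarrow> (nat \<Rightarrow> nat) measure) \<Rightarrow> bool" where
  "code n L \<epsilon> E D \<longleftrightarrow>
     E \<in> Pw n \<rightarrow>\<^sub>M prob_algebra (count_space UNIV) \<and>
     D \<in> (count_space UNIV \<Otimes>\<^sub>M Yn n) \<rightarrow>\<^sub>M prob_algebra (Xn n) \<and>
     (\<integral>\<^sup>+ z. (\<integral>\<^sup>+ b. ennreal (real (length b)) \<partial>E z) \<partial>Pw n) \<le> ennreal L \<and>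
     (\<integral>\<^sup>+ z. (\<integral>\<^sup>+ b. emeasure (D (b, ys_of n z)) (space (Xn n) - {xs_of n z}) \<partial>E z) \<partial>Pw n)
       \<le> ennreal \<epsilon>"

lemma words_in_Xn: "x \<in> words n \<Longrightarrow> {x} \<in> sets (Xn n)"
proof -
  assume x: "x \<in> words n"
  have "{x} = PiE {..<n} (\<lambda>i. {x i})" using x by (intro PiE_singleton[symmetric]) (auto simp: PiE_iff)
  also have "\<dots> \<in> sets (Xn n)" by (intro sets_PiM_I_finite) auto
  finally show ?thesis .
qed

lemma space_Xn: "space (Xn n) = words n" by (simp add: space_PiM)

text \<open>With probability \<open>T\<close> the encoder gives up and sends the empty string, which costs nothing.\<close>

lemma code_exists:
  assumes T[measurable]: "T \<in> borel_measurable (Pw n)" and T01: "\<And>z. 0 \<le> T z" "\<And>z. T z \<le> 1"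
    and err: "(\<integral>\<^sup>+z. ennreal (T z) \<partial>Pw n) \<le> ennreal \<epsilon>"
    and len: "(\<integral>\<^sup>+z. ennreal ((1 - T z) * total_info n z) \<partial>Pw n) \<le> ennreal L"
  shows "\<exists>E D. code n L \<epsilon> E D"
proof -
  \<comment> \<open>\<open>ranking_code\<close> works with natural numbers, so the words are
    enumerated. Indices outside \<open>J\<close> stand for no word and get probability 0, which
    keeps the decoder away from them.\<close>
  define idx where "idx = to_nat_on (words n)"
  define wd where "wd = from_nat_into (words n)"
  have words_ne: "words n \<noteq> {}" by (simp add: PiE_eq_empty_iff)
  have wd_words: "wd j \<in> words n" for j unfolding wd_def by (rule from_nat_into[OF words_ne])
  have wd_idx: "wd (idx x) = x" if "x \<in> words n" for x
    unfolding wd_def idx_def by (rule from_nat_into_to_nat_on[OF countable_words that])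
  define J where "J = idx ` words n"
  have wdJ: "idx (wd j) = j" if "j \<in> J" for j using that wd_idx unfolding J_def by fastforce
  have idxJ: "idx x \<in> J" if "x \<in> words n" for x using that by (simp add: J_def)
  define Q where "Q = (\<lambda>j y. if j \<in> J then qn n (wd j) y else 0)"
  have Q1: "Q j \<in> borel_measurable (Yn n)" for j
    by (cases "j \<in> J") (auto simp: Q_def)
  have Q2: "0 \<le> Q j y" for j y by (simp add: Q_def qn_nonneg)
  have Q3: "(\<Sum>j\<in>B. Q j y) \<le> 1" if "finite B" for B y
  proof -
    have inj: "inj_on wd (B \<inter> J)"
      by (rule inj_on_inverseI[of _ idx]) (simp add: wdJ)
    have "(\<Sum>j\<in>B. Q j y) = (\<Sum>j\<in>B \<inter> J. qn n (wd j) y)"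
      using that by (simp add: Q_def sum.inter_restrict)
    also have "\<dots> = (\<Sum>x\<in>wd ` (B \<inter> J). qn n x y)"
      using inj by (simp add: sum.reindex)
    also have "\<dots> \<le> 1"
      by (rule qn_sum_le_1) (simp add: that, intro image_subsetI wd_words)
    finally show ?thesis .
  qed
  obtain enc dec where
    enc[measurable]: "\<And>j. enc j \<in> Yn n \<rightarrow>\<^sub>M (count_space UNIV :: bool list measure)"
    and dec[measurable]: "\<And>b. dec b \<in> Yn n \<rightarrow>\<^sub>M (count_space UNIV :: nat measure)"
    and dec_enc: "\<And>j y. 0 < Q j y \<Longrightarrow> dec (enc j y) y = j"
    and len_enc: "\<And>j y. 0 < Q j y \<Longrightarrow> real (length (enc j y)) \<le> log 2 (1 / Q j y)"
    by (rule ranking_code[OF Q1 Q2 Q3]) (assumption, rule that, assumption+)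
  define c where "c = (\<lambda>z. enc (idx (xs_of n z)) (ys_of n z))"
  have c[measurable]: "c \<in> Pw n \<rightarrow>\<^sub>M count_space UNIV"
    unfolding c_def
    by (rule measurable_compose_countable'[OF _ xs_of_measurable countable_words]) measurable
  have Q_like: "Q (idx (xs_of n z)) (ys_of n z) = like n z" for z
    by (simp add: Q_def like_def wd_idx[OF xs_of_words] idxJ[OF xs_of_words])
  define E where "E = (\<lambda>z. measure_pmf (map_pmf (\<lambda>b. if b then [] else c z) (bernoulli_pmf (T z))))"
  have E_int: "(\<integral>\<^sup>+b. f b \<partial>E z) = f [] * ennreal (T z) + f (c z) * ennreal (1 - T z)" for f z
    using T01 by (simp add: E_def)
  define D where "D = (\<lambda>(b, y). return (Xn n) (wd (dec b y)))"
  have D_meas: "D \<in> (count_space UNIV \<Otimes>\<^sub>M Yn n) \<rightarrow>\<^sub>M prob_algebra (Xn n)"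
  proof -
    have "(\<lambda>u. dec (fst u) (snd u)) \<in> (count_space UNIV \<Otimes>\<^sub>M Yn n) \<rightarrow>\<^sub>M count_space UNIV"
      by (rule measurable_compose_countable[where g=fst]) measurable
    moreover have "wd \<in> count_space UNIV \<rightarrow>\<^sub>M Xn n"
      using wd_words by (simp add: space_Xn)
    ultimately have "(\<lambda>u. wd (dec (fst u) (snd u))) \<in> (count_space UNIV \<Otimes>\<^sub>M Yn n) \<rightarrow>\<^sub>M Xn n"
      by (rule measurable_compose)
    from measurable_compose[OF this measurable_return_prob_space] show ?thesis
      by (simp add: D_def split_beta')
  qed
  have E_meas: "E \<in> Pw n \<rightarrow>\<^sub>M prob_algebra (count_space UNIV)"
  proof (rule measurable_prob_algebraI)
    show "prob_space (E z)" for z by (simp add: E_def prob_space_measure_pmf)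
    show "E \<in> Pw n \<rightarrow>\<^sub>M subprob_algebra (count_space UNIV)"
    proof (rule measurable_subprob_algebra)
      show "subprob_space (E z)" for z
        by (simp add: E_def prob_space_imp_subprob_space prob_space_measure_pmf)
      show "sets (E z) = sets (count_space UNIV)" for z by (simp add: E_def)
      fix A :: "bool list set"
      have "emeasure (E z) A = indicator A [] * ennreal (T z) + indicator A (c z) * ennreal (1 - T z)" for z
      proof -
        have "emeasure (E z) A = (\<integral>\<^sup>+b. indicator A b \<partial>E z)"
          by (rule nn_integral_indicator[symmetric]) (simp add: E_def)
        then show ?thesis unfolding E_int .
      qed
      moreover have "(\<lambda>z. indicator A [] * ennreal (T z) + indicator A (c z) * ennreal (1 - T z))
          \<in> borel_measurable (Pw n)" by measurable
      ultimately show "(\<lambda>z. emeasure (E z) A) \<in> borel_measurable (Pw n)" by simp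
    qed
  qed
  have "(\<integral>\<^sup>+ z. (\<integral>\<^sup>+ b. ennreal (real (length b)) \<partial>E z) \<partial>Pw n)
      \<le> (\<integral>\<^sup>+z. ennreal ((1 - T z) * total_info n z) \<partial>Pw n)"
  proof (rule nn_integral_mono_AE, use AE_like in eventually_elim)
    case (elim z)
    then have "real (length (c z)) \<le> total_info n z"
      using len_enc[of "idx (xs_of n z)" "ys_of n z"] by (simp add: Q_like c_def)
    then have "(1 - T z) * real (length (c z)) \<le> (1 - T z) * total_info n z"
      using T01 by (intro mult_left_mono) auto
    then show ?case
      unfolding E_int using T01 by (simp add: ennreal_mult'[symmetric] mult.commute ennreal_leI)
  qed
  moreover have "(\<integral>\<^sup>+ z. (\<integral>\<^sup>+ b. emeasure (D (b, ys_of n z)) (space (Xn n) - {xs_of n z}) \<partial>E z) \<partial>Pw n)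
      \<le> (\<integral>\<^sup>+z. ennreal (T z) \<partial>Pw n)"
  proof (rule nn_integral_mono_AE, use AE_like in eventually_elim)
    case (elim z)
    have meas: "space (Xn n) - {xs_of n z} \<in> sets (Xn n)"
      by (intro sets.Diff sets.top words_in_Xn xs_of_words)
    have D_em: "emeasure (D (b, ys_of n z)) (space (Xn n) - {xs_of n z})
        = indicator (space (Xn n) - {xs_of n z}) (wd (dec b (ys_of n z)))" for b
      unfolding D_def using meas by simp
    have "wd (dec (c z) (ys_of n z)) = xs_of n z"
      using elim dec_enc[of "idx (xs_of n z)" "ys_of n z"]
      by (simp add: Q_like c_def wd_idx[OF xs_of_words])
    \<comment> \<open>Errors arise only from giving up. Even then the decoder treats the empty
      string as rank 0 and may be right by chance, so the error probability is only bounded by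
      \<open>T z\<close>.\<close>
    then have "(\<integral>\<^sup>+ b. emeasure (D (b, ys_of n z)) (space (Xn n) - {xs_of n z}) \<partial>E z)
        = indicator (space (Xn n) - {xs_of n z}) (wd (dec [] (ys_of n z))) * ennreal (T z)"
      unfolding E_int D_em by simp
    also have "\<dots> \<le> 1 * ennreal (T z)" by (intro mult_right_mono) (auto simp: indicator_def)
    finally show ?case by simp
  qed
  ultimately have "code n L \<epsilon> E D"
    unfolding code_def using E_meas D_meas err len by (auto intro: order_trans)
  then show ?thesis by blast
qed

text \<open>Dividing by the likelihood turns the average over \<open>x\<close> into a plain sum over all \<open>x\<close>, in which
  the output distribution of the decoder has mass at most one.\<close>

lemma guess_over_like_le_1:
  assumes K: "K \<in> Yn n \<rightarrow>\<^sub>M prob_algebra (Xn n)"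
  shows "(\<integral>\<^sup>+z. emeasure (K (ys_of n z)) {xs_of n z} * ennreal (1 / like n z) \<partial>Pw n) \<le> 1"
proof -
  have K': "K \<in> Yn n \<rightarrow>\<^sub>M subprob_algebra (Xn n)" by (rule measurable_prob_algebraD[OF K])
  have Km[measurable]: "(\<lambda>y. emeasure (K y) {x}) \<in> borel_measurable (Yn n)" if "x \<in> words n" for x
    by (rule measurable_emeasure_kernel[OF K' words_in_Xn[OF that]])
  interpret \<mu>n: prob_space "PiM {..<n} (\<lambda>_. \<mu>)" by (intro prob_space_PiM prob_\<mu>)
  have "(\<integral>\<^sup>+z. emeasure (K (ys_of n z)) {xs_of n z} * ennreal (1 / like n z) \<partial>Pw n)
    = (\<integral>\<^sup>+z. \<integral>\<^sup>+x. (emeasure (K (ys_of n z)) {x} * ennreal (1 / qn n x (ys_of n z)))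
        * indicator {z. xs_of n z = x} z \<partial>count_space (words n) \<partial>Pw n)"
  proof (rule nn_integral_cong)
    fix z
    show "emeasure (K (ys_of n z)) {xs_of n z} * ennreal (1 / like n z)
      = (\<integral>\<^sup>+x. (emeasure (K (ys_of n z)) {x} * ennreal (1 / qn n x (ys_of n z)))
        * indicator {z. xs_of n z = x} z \<partial>count_space (words n))"
      by (subst nn_integral_count_space'[where A="{xs_of n z}"])
        (use xs_of_words[of n z] in \<open>auto simp: like_def\<close>)
  qed
  also have "\<dots> = (\<integral>\<^sup>+x. \<integral>\<^sup>+z. (emeasure (K (ys_of n z)) {x} * ennreal (1 / qn n x (ys_of n z)))
        * indicator {z. xs_of n z = x} z \<partial>Pw n \<partial>count_space (words n))"
  proof (rule nn_integral_count_space_nn_integral[OF countable_words])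
    fix x assume x[measurable]: "x \<in> words n"
    have "xs_of n -` {x} \<inter> space (Pw n) \<in> sets (Pw n)"
      by (rule measurable_sets[OF xs_of_measurable]) (use x in simp)
    then have "{z \<in> space (Pw n). xs_of n z = x} \<in> sets (Pw n)"
      by (simp add: vimage_def Int_def conj_commute)
    then have [measurable]: "Measurable.pred (Pw n) (\<lambda>z. xs_of n z = x)" by (simp add: pred_def)
    show "(\<lambda>z. (emeasure (K (ys_of n z)) {x} * ennreal (1 / qn n x (ys_of n z)))
        * indicator {z. xs_of n z = x} z) \<in> borel_measurable (Pw n)"
      using measurable_compose[OF ys_of_measurable Km[OF x]] by measurable
  qed
  also have "\<dots> \<le> (\<integral>\<^sup>+x. \<integral>\<^sup>+y. emeasure (K y) {x} \<partial>PiM {..<n} (\<lambda>_. \<mu>) \<partial>count_space (words n))"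
  proof (rule nn_integral_mono)
    fix x assume "x \<in> space (count_space (words n))"
    then have x: "x \<in> words n" by simp
    have "(\<integral>\<^sup>+z. (emeasure (K (ys_of n z)) {x} * ennreal (1 / qn n x (ys_of n z)))
        * indicator {z. xs_of n z = x} z \<partial>Pw n)
      = (\<integral>\<^sup>+y. ennreal (qn n x y) * (emeasure (K y) {x} * ennreal (1 / qn n x y)) \<partial>PiM {..<n} (\<lambda>_. \<mu>))"
      by (rule nn_integral_xs_fixed[OF x, of "\<lambda>y. emeasure (K y) {x} * ennreal (1 / qn n x y)"])
        (use Km[OF x] in measurable)
    also have "\<dots> \<le> (\<integral>\<^sup>+y. emeasure (K y) {x} \<partial>PiM {..<n} (\<lambda>_. \<mu>))"
    proof (rule nn_integral_mono)
      fix y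
      have "ennreal (qn n x y) * (emeasure (K y) {x} * ennreal (1 / qn n x y))
          = ennreal (qn n x y * (1 / qn n x y)) * emeasure (K y) {x}"
        using qn_nonneg[of n x y] by (subst ennreal_mult') (auto simp: mult_ac simp del: times_divide_eq_right)
      \<comment> \<open>Equality fails where \<open>qn n x y = 0\<close>, as the product with the
        reciprocal is then 0 instead of 1.\<close>
      also have "\<dots> \<le> 1 * emeasure (K y) {x}"
        by (intro mult_right_mono) auto
      finally show "ennreal (qn n x y) * (emeasure (K y) {x} * ennreal (1 / qn n x y)) \<le> emeasure (K y) {x}"
        by simp
    qed
    finally show "(\<integral>\<^sup>+z. (emeasure (K (ys_of n z)) {x} * ennreal (1 / qn n x (ys_of n z)))
        * indicator {z. xs_of n z = x} z \<partial>Pw n) \<le> (\<integral>\<^sup>+y. emeasure (K y) {x} \<partial>PiM {..<n} (\<lambda>_. \<mu>))" .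
  qed
  also have "\<dots> = (\<integral>\<^sup>+y. \<integral>\<^sup>+x. emeasure (K y) {x} \<partial>count_space (words n) \<partial>PiM {..<n} (\<lambda>_. \<mu>))"
  proof (rule nn_integral_count_space_nn_integral[OF countable_words, symmetric])
    fix x assume x: "x \<in> words n"
    show "(\<lambda>y. emeasure (K y) {x}) \<in> borel_measurable (PiM {..<n} (\<lambda>_. \<mu>))"
      using Km[OF x] by measurable
  qed
  also have "\<dots> \<le> (\<integral>\<^sup>+y. 1 \<partial>PiM {..<n} (\<lambda>_. \<mu>))"
  proof (rule nn_integral_mono)
    fix y assume "y \<in> space (PiM {..<n} (\<lambda>_. \<mu>))"
    then have y: "y \<in> space (Yn n)"
      using sets_eq_imp_space_eq[OF sets_\<mu>] by (simp add: space_PiM)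
    then have Ky: "prob_space (K y)" "sets (K y) = sets (Xn n)"
      using measurable_space[OF K y] by (auto simp: space_prob_algebra)
    have "(\<integral>\<^sup>+x. emeasure (K y) {x} \<partial>count_space (words n)) = emeasure (K y) (words n)"
      by (rule emeasure_countable_singleton[symmetric])
        (use words_in_Xn countable_words Ky in auto)
    also have "\<dots> \<le> 1" by (rule prob_space.emeasure_le_1[OF Ky(1)])
    finally show "(\<integral>\<^sup>+x. emeasure (K y) {x} \<partial>count_space (words n)) \<le> 1" .
  qed
  also have "\<dots> = 1" by (simp add: \<mu>n.emeasure_space_1)
  finally show ?thesis .
qed

text \<open>The pointwise converse, with \<open>p\<close> the likelihood, \<open>c\<close> the
  probability that the decoder hits and \<open>w\<close> the weight of the string sent. A miss is
  charged \<open>t\<close>. A hit is charged the information, split as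
  \<open>- log 2 w + log 2 (w / p)\<close>, and the second logarithm is at most
  \<open>w / p / ln 2\<close>.\<close>

lemma log_likelihood_ratio_bound:
  assumes "0 < p" "0 < w" "w \<le> 1" "0 \<le> c" "c \<le> 1" "0 \<le> t"
  shows "min (log 2 (1 / p)) t \<le> t * (1 - c) + - log 2 w + c * (1 / p) * (w / ln 2)"
proof -
  let ?S = "log 2 (1 / p)"
  have w: "0 \<le> - log 2 w" using assms by simp
  have "min ?S t = (1 - c) * min ?S t + c * min ?S t" by (simp add: algebra_simps)
  also have "\<dots> \<le> (1 - c) * t + c * ?S"
    using assms by (intro add_mono mult_left_mono) auto
  also have "c * ?S \<le> c * (- log 2 w + w / p / ln 2)"
  proof (intro mult_left_mono assms)
    have "ln (w / p) \<le> w / p - 1" using assms by (intro ln_le_minus_one) simp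
    then have "ln (w / p) \<le> w / p" by linarith
    then have "ln (w / p) / ln 2 \<le> w / p / ln 2" by (rule divide_right_mono) simp
    moreover have "?S = - log 2 w + log 2 (w / p)" using assms by (simp add: log_divide)
    ultimately show "?S \<le> - log 2 w + w / p / ln 2" by (simp only: log_def)
  qed
  also have "c * (- log 2 w + w / p / ln 2) \<le> - log 2 w + c * (1 / p) * (w / ln 2)"
    using mult_right_mono[OF assms(5) w] by (simp add: algebra_simps)
  finally show ?thesis by (simp add: algebra_simps)
qed

text \<open>Integrated, the three terms of \<open>log_likelihood_ratio_bound\<close> give
  \<open>t\<close> times the error probability, the expected length with its overhead, and at most
  \<open>1 / ln 2\<close>: for each string the hits over the likelihood have mean at most 1, and the
  weights sum to at most 1.\<close>

lemma code_length_lower_bound: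
  assumes code: "code n L \<epsilon> E D" and n: "n \<ge> 1" and t: "0 \<le> t" and \<epsilon>: "0 \<le> \<epsilon>" and L: "0 \<le> L"
  shows "(\<integral>z. min (total_info n z) t \<partial>Pw n)
    \<le> t * \<epsilon> + ((1 + 1 / real n) * L + (2 + log 2 (real n))) + 1 / ln 2"
proof -
  define a where "a = 1 + 1 / real n"
  define k where "k = 2 + log 2 (real n)"
  define w where "w = (\<lambda>b::bool list. 2 powr (- a * real (length b)) / (4 * real n))"
  define hit where "hit = (\<lambda>z b. emeasure (D (b, ys_of n z)) {xs_of n z})"
  define miss where "miss = (\<lambda>z b. emeasure (D (b, ys_of n z)) (space (Xn n) - {xs_of n z}))"
  have E: "E \<in> Pw n \<rightarrow>\<^sub>M prob_algebra (count_space UNIV)"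
    and D: "D \<in> (count_space UNIV \<Otimes>\<^sub>M Yn n) \<rightarrow>\<^sub>M prob_algebra (Xn n)"
    and len: "(\<integral>\<^sup>+ z. (\<integral>\<^sup>+ b. ennreal (real (length b)) \<partial>E z) \<partial>Pw n) \<le> ennreal L"
    and err: "(\<integral>\<^sup>+ z. (\<integral>\<^sup>+ b. miss z b \<partial>E z) \<partial>Pw n) \<le> ennreal \<epsilon>"
    using code by (auto simp: code_def miss_def)
  interpret Q: prob_space "Pw n" by (rule prob_space_PiM_const) (rule prob_P)
  have a: "0 \<le> a" and k: "0 \<le> k" using n by (auto simp: a_def k_def)
  have w_pos: "0 < w b" for b using n by (simp add: w_def)
  have w_log: "- log 2 (w b) = a * real (length b) + k" for b
    using n log_mult[of 2 4 "real n"] log_pow_cancel[of "2::real" 2]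
    by (simp add: w_def k_def log_divide)
  have w_le_1: "w b \<le> 1" for b
  proof -
    have "0 \<le> - log 2 (w b)" unfolding w_log using a k by simp
    then show ?thesis using w_pos[of b] by simp
  qed
  have Db: "(\<lambda>y. D (b, y)) \<in> Yn n \<rightarrow>\<^sub>M prob_algebra (Xn n)" for b
    by (rule measurable_compose[OF measurable_Pair1' D]) simp
  have Dz: "(\<lambda>z. D (b, ys_of n z)) \<in> Pw n \<rightarrow>\<^sub>M subprob_algebra (Xn n)" for b
    by (rule measurable_prob_algebraD[OF measurable_compose[OF ys_of_measurable Db]])
  have hit_z: "(\<lambda>z. hit z b) \<in> borel_measurable (Pw n)" for b
    unfolding hit_def
    by (rule measurable_compose_countable'[OF _ xs_of_measurable countable_words])
      (rule measurable_emeasure_kernel[OF Dz words_in_Xn])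
  have miss_z: "(\<lambda>z. miss z b) \<in> borel_measurable (Pw n)" for b
    unfolding miss_def
    by (rule measurable_compose_countable'[OF _ xs_of_measurable countable_words])
      (rule measurable_emeasure_kernel[OF Dz sets.Diff[OF sets.top words_in_Xn]])
  have E_int_meas: "(\<lambda>z. \<integral>\<^sup>+b. g z b \<partial>E z) \<in> borel_measurable (Pw n)"
    if "\<And>b. (\<lambda>z. g z b) \<in> borel_measurable (Pw n)" for g :: "_ \<Rightarrow> bool list \<Rightarrow> ennreal"
  proof (rule nn_integral_measurable_subprob_algebra2[OF _ measurable_prob_algebraD[OF E]])
    show "(\<lambda>(z, b). g z b) \<in> borel_measurable (Pw n \<Otimes>\<^sub>M count_space UNIV)"
      unfolding split_beta'
      by (rule measurable_compose_countable[where g=snd])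
        (auto intro: measurable_compose[OF measurable_fst that])
  qed
  have Ez: "prob_space (E z)" "sets (E z) = UNIV" if "z \<in> space (Pw n)" for z
    using measurable_space[OF E that] by (auto simp: space_prob_algebra)
  have E_meas: "f \<in> borel_measurable (E z)" if "z \<in> space (Pw n)" for f :: "bool list \<Rightarrow> ennreal" and z
    using Ez(2)[OF that] sets_eq_imp_space_eq[of "E z" "count_space UNIV"]
    by (simp add: measurable_def)
  have inv_like: "(\<lambda>z. ennreal (1 / like n z)) \<in> borel_measurable (Pw n)" by measurable
  define G where "G = (\<lambda>z b. hit z b * ennreal (1 / like n z) * ennreal (w b / ln 2))"
  have G_z: "(\<lambda>z. G z b) \<in> borel_measurable (Pw n)" for b
    unfolding G_def using hit_z[of b] by measurable
  have G_bound: "(\<integral>\<^sup>+z. \<integral>\<^sup>+b. G z b \<partial>E z \<partial>Pw n) \<le> ennreal (1 / ln 2)"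
  proof -
    \<comment> \<open>The encoder sees the source word, so its law cannot be averaged out. Bounding
      its point masses by 1 removes it; for a fixed string, the decoder then guesses from the side
      information alone.\<close>
    have "(\<integral>\<^sup>+z. \<integral>\<^sup>+b. G z b \<partial>E z \<partial>Pw n) \<le> (\<integral>\<^sup>+z. \<integral>\<^sup>+b. G z b \<partial>count_space UNIV \<partial>Pw n)"
    proof (rule nn_integral_mono)
      fix z assume z: "z \<in> space (Pw n)"
      have "(\<integral>\<^sup>+b. G z b \<partial>E z) = (\<integral>\<^sup>+b. emeasure (E z) {b} * G z b \<partial>count_space UNIV)"
        by (rule nn_integral_countable_singletons[OF Ez(2)[OF z]])
      also have "\<dots> \<le> (\<integral>\<^sup>+b. 1 * G z b \<partial>count_space UNIV)"
        by (intro nn_integral_mono mult_right_mono prob_space.emeasure_le_1[OF Ez(1)[OF z]]) simp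
      finally show "(\<integral>\<^sup>+b. G z b \<partial>E z) \<le> (\<integral>\<^sup>+b. G z b \<partial>count_space UNIV)" by simp
    qed
    also have "\<dots> = (\<integral>\<^sup>+b. \<integral>\<^sup>+z. G z b \<partial>Pw n \<partial>count_space UNIV)"
      by (rule nn_integral_count_space_nn_integral) (simp_all add: G_z)
    also have "\<dots> \<le> (\<integral>\<^sup>+b. ennreal (1 / ln 2) * ennreal (w b) \<partial>count_space UNIV)"
    proof (rule nn_integral_mono)
      fix b
      have "(\<integral>\<^sup>+z. G z b \<partial>Pw n) = (\<integral>\<^sup>+z. hit z b * ennreal (1 / like n z) \<partial>Pw n) * ennreal (w b / ln 2)"
        unfolding G_def by (intro nn_integral_multc borel_measurable_times_ennreal hit_z inv_like)
      also have "\<dots> \<le> 1 * ennreal (w b / ln 2)"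
        unfolding hit_def by (intro mult_right_mono guess_over_like_le_1[OF Db]) simp
      also have "\<dots> = ennreal (1 / ln 2) * ennreal (w b)"
        using w_pos[of b] by (simp add: ennreal_mult'[symmetric])
      finally show "(\<integral>\<^sup>+z. G z b \<partial>Pw n) \<le> ennreal (1 / ln 2) * ennreal (w b)" .
    qed
    also have "\<dots> = ennreal (1 / ln 2) * (\<integral>\<^sup>+b. ennreal (w b) \<partial>count_space UNIV)"
      by (rule nn_integral_cmult) simp
    also have "\<dots> \<le> ennreal (1 / ln 2) * 1"
      unfolding w_def a_def by (intro mult_left_mono geometric_length_weight n) simp
    finally show ?thesis by simp
  qed
  have "(\<integral>\<^sup>+z. ennreal (min (total_info n z) t) \<partial>Pw n)
      \<le> (\<integral>\<^sup>+z. ennreal t * (\<integral>\<^sup>+b. miss z b \<partial>E z)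
          + (ennreal a * (\<integral>\<^sup>+b. ennreal (real (length b)) \<partial>E z) + ennreal k)
          + (\<integral>\<^sup>+b. G z b \<partial>E z) \<partial>Pw n)"
  proof (rule nn_integral_mono_AE, use AE_like AE_space in eventually_elim)
    case (elim z)
    then have z: "z \<in> space (Pw n)" and p: "0 < like n z" and S: "log 2 (1 / like n z) = total_info n z"
      by auto
    interpret Ez: prob_space "E z" by (rule Ez(1)[OF z])
    have pt: "ennreal (min (total_info n z) t)
        \<le> ennreal t * miss z b + (ennreal a * ennreal (real (length b)) + ennreal k) + G z b" for b
    proof -
      have ysz: "(b, ys_of n z) \<in> space (count_space UNIV \<Otimes>\<^sub>M Yn n)"
        using measurable_space[OF ys_of_measurable z] by (simp add: space_pair_measure)
      then have Dp: "prob_space (D (b, ys_of n z))" "sets (D (b, ys_of n z)) = sets (Xn n)"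
        using measurable_space[OF D] by (auto simp: space_prob_algebra)
      interpret Dz: prob_space "D (b, ys_of n z)" by (rule Dp(1))
      define c where "c = measure (D (b, ys_of n z)) {xs_of n z}"
      have hit: "hit z b = ennreal c" by (simp add: hit_def c_def Dz.emeasure_eq_measure)
      have sing: "{xs_of n z} \<in> sets (D (b, ys_of n z))"
        unfolding Dp(2) by (rule words_in_Xn[OF xs_of_words])
      have miss: "miss z b = ennreal (1 - c)"
        using Dz.prob_compl[OF sing] sets_eq_imp_space_eq[OF Dp(2)]
        by (simp add: miss_def c_def Dz.emeasure_eq_measure)
      have c: "0 \<le> c" "c \<le> 1" by (auto simp: c_def)
      have "min (total_info n z) t
          \<le> t * (1 - c) + (a * real (length b) + k) + c * (1 / like n z) * (w b / ln 2)"
        using log_likelihood_ratio_bound[OF p w_pos w_le_1 c t, of b] unfolding S w_log .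
      then have "ennreal (min (total_info n z) t)
          \<le> ennreal (t * (1 - c) + (a * real (length b) + k) + c * (1 / like n z) * (w b / ln 2))"
        by (rule ennreal_leI)
      also have "\<dots> = ennreal t * miss z b + (ennreal a * ennreal (real (length b)) + ennreal k) + G z b"
        using c t a k p w_pos[of b]
        by (simp add: G_def hit miss ennreal_plus[symmetric] ennreal_mult'[symmetric]
            del: ennreal_plus)
      finally show ?thesis .
    qed
    note [measurable] = E_meas[OF z]
    have "ennreal (min (total_info n z) t) = (\<integral>\<^sup>+b. ennreal (min (total_info n z) t) \<partial>E z)"
      by (simp add: Ez.emeasure_space_1)
    also have "\<dots> \<le> (\<integral>\<^sup>+b. ennreal t * miss z b + (ennreal a * ennreal (real (length b)) + ennreal k) + G z b \<partial>E z)"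
      by (rule nn_integral_mono) (rule pt)
    also have "\<dots> = ennreal t * (\<integral>\<^sup>+b. miss z b \<partial>E z)
          + (ennreal a * (\<integral>\<^sup>+b. ennreal (real (length b)) \<partial>E z) + ennreal k)
          + (\<integral>\<^sup>+b. G z b \<partial>E z)"
      by (simp add: nn_integral_add nn_integral_cmult E_meas[OF z] Ez.emeasure_space_1)
    finally show ?case .
  qed
  also have "\<dots> = ennreal t * (\<integral>\<^sup>+z. \<integral>\<^sup>+b. miss z b \<partial>E z \<partial>Pw n)
          + (ennreal a * (\<integral>\<^sup>+z. \<integral>\<^sup>+b. ennreal (real (length b)) \<partial>E z \<partial>Pw n) + ennreal k)
          + (\<integral>\<^sup>+z. \<integral>\<^sup>+b. G z b \<partial>E z \<partial>Pw n)"
    using E_int_meas[OF miss_z] E_int_meas[OF G_z] E_int_meas[of "\<lambda>z b. ennreal (real (length b))"]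
    by (simp add: nn_integral_add nn_integral_cmult Q.emeasure_space_1)
  also have "\<dots> \<le> ennreal t * ennreal \<epsilon> + (ennreal a * ennreal L + ennreal k) + ennreal (1 / ln 2)"
    by (intro add_mono mult_left_mono err len G_bound order_refl) auto
  also have "\<dots> = ennreal (t * \<epsilon> + (a * L + k) + 1 / ln 2)"
    using t \<epsilon> a L k by (simp add: ennreal_plus[symmetric] ennreal_mult'[symmetric] del: ennreal_plus)
  finally have "(\<integral>\<^sup>+z. ennreal (min (total_info n z) t) \<partial>Pw n) \<le> ennreal (t * \<epsilon> + (a * L + k) + 1 / ln 2)" .
  moreover have "integrable (Pw n) (\<lambda>z. min (total_info n z) t)"
    by (rule Q.integrable_const_bound[where B=t]) (use t total_info_nonneg in auto)
  ultimately have "ennreal (\<integral>z. min (total_info n z) t \<partial>Pw n) \<le> ennreal (t * \<epsilon> + (a * L + k) + 1 / ln 2)"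
    using t total_info_nonneg by (subst nn_integral_eq_integral[symmetric]) auto
  moreover have "0 \<le> t * \<epsilon> + (a * L + k) + 1 / ln 2" using t \<epsilon> a L k by simp
  ultimately show ?thesis unfolding a_def k_def by (simp only: ennreal_le_iff)
qed

end

section \<open>Optimal lengths\<close>

text \<open>A ramp \<open>T\<close> of width 1 instead of a randomized quantile: its mean depends continuously on its
  position, and replacing the jump by the ramp costs at most one bit.\<close>

lemma (in prob_space) ramp_of_mean:
  fixes S :: "'a \<Rightarrow> real"
  assumes S: "integrable M S" and S_nonneg: "\<And>z. 0 \<le> S z" and \<epsilon>: "0 < \<epsilon>" "\<epsilon> < 1"
  obtains T u where "T \<in> borel_measurable M" "\<And>z. 0 \<le> T z" "\<And>z. T z \<le> 1"
    "(\<integral>z. T z \<partial>M) = \<epsilon>" "\<And>z. max 0 (S z - u) - 1 \<le> T z * (S z - u)"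
proof -
  have [measurable]: "S \<in> borel_measurable M" using S by simp
  define T where "T = (\<lambda>u z. max 0 (min 1 (S z - u)))"
  have T01: "0 \<le> T u z" "T u z \<le> 1" for u z by (auto simp: T_def)
  have T_meas[measurable]: "T u \<in> borel_measurable M" for u unfolding T_def by measurable
  have T_int: "integrable M (T u)" for u
    by (rule integrable_const_bound[where B=1]) (use T01 in auto)
  define g where "g = (\<lambda>u. \<integral>z. T u z \<partial>M)"
  have lip: "\<bar>g u - g v\<bar> \<le> \<bar>u - v\<bar>" for u v
  proof -
    have "\<bar>g u - g v\<bar> = \<bar>\<integral>z. T u z - T v z \<partial>M\<bar>"
      using T_int by (simp add: g_def)
    also have "\<dots> \<le> (\<integral>z. \<bar>T u z - T v z\<bar> \<partial>M)" by (rule integral_abs_bound)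
    also have "\<dots> \<le> (\<integral>z. \<bar>u - v\<bar> \<partial>M)"
      using T_int by (intro integral_mono) (auto simp: T_def)
    finally show ?thesis by (simp add: prob_space)
  qed
  have cont: "continuous_on {-1..b} g" for b
    unfolding continuous_on_iff dist_real_def using lip by (meson le_less_trans)
  \<comment> \<open>By Markov's inequality the ramp at \<open>b\<close> has mean at most
    \<open>\<epsilon>\<close>; the summand 1 makes \<open>b\<close> positive. At -1 the ramp is
    constantly 1 because \<open>S\<close> is nonnegative, and the mean is continuous in
    between.\<close>
  define b where "b = expectation S / \<epsilon> + 1"
  have ES: "0 \<le> expectation S" using S_nonneg by simp
  have b: "b > 0" using ES \<epsilon> by (simp add: b_def add_nonneg_pos)
  have "g b \<le> (\<integral>z. S z / b \<partial>M)"
    unfolding g_def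
  proof (intro integral_mono T_int)
    fix z
    show "T b z \<le> S z / b"
    proof (cases "S z \<le> b")
      case True
      then show ?thesis using S_nonneg[of z] b by (simp add: T_def)
    next
      case False
      then have "1 \<le> S z / b" using b by simp
      then show ?thesis using T01(2)[of b z] by linarith
    qed
  qed (use S in simp)
  also have "\<dots> \<le> \<epsilon>" using b \<epsilon> ES by (simp add: b_def field_simps)
  finally have gb: "g b \<le> \<epsilon>" .
  have "T (-1) = (\<lambda>_. 1)" using S_nonneg by (auto simp: T_def fun_eq_iff min_def max_def add_nonneg_pos)
  then have "g (-1) = 1" by (simp add: g_def prob_space)
  then obtain u where u: "g u = \<epsilon>"
    using IVT2'[of g b \<epsilon> "-1"] gb \<epsilon> cont[of b] b by auto
  show ?thesis
  proof
    show "(\<integral>z. T u z \<partial>M) = \<epsilon>" using u by (simp add: g_def)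
    show "max 0 (S z - u) - 1 \<le> T u z * (S z - u)" for z
      using zero_le_square[of "S z - u"]
      by (cases "S z - u \<le> 1") (auto simp: T_def max_def min_def intro: order_trans[of _ 0])
  qed (use T01 T_meas in auto)
qed

context cond_source
begin

definition opt_length :: "nat \<Rightarrow> real \<Rightarrow> real" where
  "opt_length n \<epsilon> = Inf {L. L > 0 \<and> (\<exists>E D. code n L \<epsilon> E D)}"

text \<open>Only codes above \<open>L0\<close> are asked for, since admissible lengths are positive
  while \<open>L0\<close> may be 0. Nonemptiness is recorded because the lower bound on the infimum
  depends on it.\<close>

lemma opt_length_le:
  assumes "\<And>L. L0 < L \<Longrightarrow> \<exists>E D. code n L \<epsilon> E D" and "0 \<le> L0"
  shows "opt_length n \<epsilon> \<le> L0" "{L. L > 0 \<and> (\<exists>E D. code n L \<epsilon> E D)} \<noteq> {}"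
proof -
  let ?A = "{L. L > 0 \<and> (\<exists>E D. code n L \<epsilon> E D)}"
  have in_A: "L0 + \<delta> \<in> ?A" if "\<delta> > 0" for \<delta>
    using assms(1)[of "L0 + \<delta>"] assms(2) that by auto
  have "bdd_below ?A" by (rule bdd_belowI[where m=0]) auto
  then have "opt_length n \<epsilon> \<le> L0 + \<delta>" if "\<delta> > 0" for \<delta>
    unfolding opt_length_def using in_A[OF that] by (intro cInf_lower)
  then show "opt_length n \<epsilon> \<le> L0" by (rule field_le_epsilon)
  show "?A \<noteq> {}" using in_A[of 1] by auto
qed

end

section \<open>Gaussian evaluation of the optimal length\<close>

locale cond_source_third_moment = cond_source +
  assumes info_integrable: "integrable P info"
    and info_third: "integrable P (\<lambda>z. \<bar>info z - (\<integral>z. info z \<partial>P)\<bar> ^ 3)"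
begin

definition "H = (\<integral>z. info z \<partial>P)"

lemma centered: "centered_third_moment P (\<lambda>z. info z - H)"
proof -
  interpret P: prob_space P by (rule prob_P)
  show ?thesis
  proof
    show "(\<integral>z. info z - H \<partial>P) = 0" using info_integrable by (simp add: H_def P.prob_space)
  qed (use info_integrable info_third in \<open>auto simp: H_def\<close>)
qed

sublocale W: centered_third_moment P "\<lambda>z. info z - H" by (rule centered)

lemma H_nonneg: "0 \<le> H" by (simp add: H_def info_nonneg)

lemma prob_Pw: "prob_space (Pw n)" by (rule prob_space_PiM_const) (rule prob_P)

lemma total_info_eq: "total_info n z = real n * H + (\<Sum>i<n. info (z i) - H)"
  by (simp add: total_info_def sum_subtractf)

lemma total_info_integrable: "integrable (Pw n) (total_info n)"
  unfolding total_info_def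
  using info_integrable by (intro Bochner_Integration.integrable_sum integrable_PiM_component_const prob_P) auto

lemma total_info_mean: "(\<integral>z. total_info n z \<partial>Pw n) = real n * H"
proof -
  have "(\<integral>z. total_info n z \<partial>Pw n) = (\<Sum>i<n. \<integral>z. info (z i) \<partial>Pw n)"
    unfolding total_info_def
    using info_integrable by (intro Bochner_Integration.integral_sum integrable_PiM_component_const prob_P) auto
  also have "\<dots> = (\<Sum>i<n. H)"
    unfolding H_def by (intro sum.cong integral_PiM_component_const prob_P) auto
  finally show ?thesis by simp
qed

definition "excess n t = (\<integral>z. max 0 (total_info n z - t) \<partial>Pw n)"

text \<open>The summand 1 keeps the variance away from 0, where the derivatives of the hinge function
  blow up.\<close>

definition "var n = 1 + real n * W.Vw"

definition "rem n = 1 + (\<Sum>k<n. W.Kw / (1 + real k * W.Vw))"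

lemma var_ge_1: "1 \<le> var n" by (simp add: var_def W.Vw_nonneg)

lemma rem_nonneg: "0 \<le> rem n"
  unfolding rem_def using W.Kw_nonneg W.Vw_nonneg by (intro add_nonneg_nonneg sum_nonneg divide_nonneg_nonneg) auto

lemma excess_hinge: "\<bar>excess n (real n * H - y) - hinge y (var n)\<bar> \<le> rem n"
proof -
  have "excess n (real n * H - y) = (\<integral>z. max 0 (y + (\<Sum>i<n. info (z i) - H)) \<partial>Pw n)"
    unfolding excess_def total_info_eq by (simp add: algebra_simps)
  then show ?thesis using W.excess_approx[of n y] by (simp add: var_def rem_def)
qed

text \<open>With \<open>y = n * H - u\<close>, the ramp gives the length \<open>n * (1 - \<epsilon>)
  * H - (hinge y (var n) - y * \<epsilon>)\<close> up to \<open>rem n + 1\<close>. The Legendre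
  inequality holds for all \<open>y\<close>, so the position \<open>u\<close> need not be
  known.\<close>

lemma opt_length_upper:
  assumes \<epsilon>: "0 < \<epsilon>" "\<epsilon> < 1"
  shows "opt_length n \<epsilon> \<le> real n * (1 - \<epsilon>) * H - sqrt (var n) * fG \<epsilon> + 1 + rem n"
    and "{L. L > 0 \<and> (\<exists>E D. code n L \<epsilon> E D)} \<noteq> {}"
proof -
  interpret Q: prob_space "Pw n" by (rule prob_Pw)
  obtain T u where T[measurable]: "T \<in> borel_measurable (Pw n)" and T01: "\<And>z. 0 \<le> T z" "\<And>z. T z \<le> 1"
    and T_mean: "(\<integral>z. T z \<partial>Pw n) = \<epsilon>"
    and T_exc: "\<And>z. max 0 (total_info n z - u) - 1 \<le> T z * (total_info n z - u)"
    by (rule Q.ramp_of_mean[OF total_info_integrable total_info_nonneg \<epsilon>]) blast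
  define L0 where "L0 = (\<integral>z. (1 - T z) * total_info n z \<partial>Pw n)"
  have T_int: "integrable (Pw n) T"
    by (rule Q.integrable_const_bound[where B=1]) (use T01 in auto)
  have bounded_int: "integrable (Pw n) (\<lambda>z. f z * total_info n z)"
    if [measurable]: "f \<in> borel_measurable (Pw n)" and f: "\<And>z. 0 \<le> f z" "\<And>z. f z \<le> 1" for f
  proof (rule Bochner_Integration.integrable_bound[OF total_info_integrable])
    show "AE z in Pw n. norm (f z * total_info n z) \<le> norm (total_info n z)"
      using f total_info_nonneg by (auto simp: abs_mult intro!: mult_left_le_one_le)
  qed simp
  have L0_nonneg: "0 \<le> L0"
    unfolding L0_def using T01 total_info_nonneg by (intro Bochner_Integration.integral_nonneg) auto
  have len: "(\<integral>\<^sup>+z. ennreal ((1 - T z) * total_info n z) \<partial>Pw n) = ennreal L0"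
    unfolding L0_def using T01 total_info_nonneg
    by (intro nn_integral_eq_integral bounded_int) auto
  have err: "(\<integral>\<^sup>+z. ennreal (T z) \<partial>Pw n) = ennreal \<epsilon>"
    using nn_integral_eq_integral[OF T_int] T01 T_mean by simp
  have codes: "\<exists>E D. code n L \<epsilon> E D" if "L0 < L" for L
    by (rule code_exists[OF T T01]) (use err len that in \<open>auto intro: ennreal_leI\<close>)
  show "{L. L > 0 \<and> (\<exists>E D. code n L \<epsilon> E D)} \<noteq> {}"
    by (rule opt_length_le(2)[OF codes L0_nonneg])
  define y where "y = real n * H - u"
  have y: "u = real n * H - y" by (simp add: y_def)
  have TS: "integrable (Pw n) (\<lambda>z. T z * (total_info n z - u))"
    using bounded_int[OF T T01] T_int by (simp add: right_diff_distrib)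
  have "L0 = real n * H - (\<integral>z. T z * total_info n z \<partial>Pw n)"
    using bounded_int[OF T T01] total_info_integrable total_info_mean
    by (simp add: L0_def left_diff_distrib)
  also have "(\<integral>z. T z * total_info n z \<partial>Pw n) = (\<integral>z. T z * (total_info n z - u) \<partial>Pw n) + u * \<epsilon>"
    using bounded_int[OF T T01] T_int T_mean by (simp add: right_diff_distrib)
  finally have L0: "L0 = real n * H - (\<integral>z. T z * (total_info n z - u) \<partial>Pw n) - u * \<epsilon>" by simp
  have "(\<integral>z. max 0 (total_info n z - u) - 1 \<partial>Pw n) \<le> (\<integral>z. T z * (total_info n z - u) \<partial>Pw n)"
    using total_info_integrable TS T_exc by (intro integral_mono) auto
  then have "excess n u - 1 \<le> (\<integral>z. T z * (total_info n z - u) \<partial>Pw n)"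
    using total_info_integrable by (simp add: excess_def Q.prob_space)
  then have "L0 \<le> real n * H - (hinge y (var n) - rem n - 1) - u * \<epsilon>"
    using excess_hinge[of n y] L0 unfolding y by linarith
  moreover obtain x where x: "Phi x = \<epsilon>" using Phi_surj[OF \<epsilon>] by blast
  have "sqrt (var n) * fG \<epsilon> \<le> hinge y (var n) - y * \<epsilon>"
    using hinge_legendre(1)[of "var n" x y] var_ge_1[of n] \<epsilon> unfolding x by simp
  ultimately have "L0 \<le> real n * (1 - \<epsilon>) * H - sqrt (var n) * fG \<epsilon> + 1 + rem n"
    unfolding y by (simp add: algebra_simps)
  then show "opt_length n \<epsilon> \<le> real n * (1 - \<epsilon>) * H - sqrt (var n) * fG \<epsilon> + 1 + rem n"
    using opt_length_le(1)[OF codes L0_nonneg] by linarith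
qed

lemma opt_length_upper_0:
  "opt_length n 0 \<le> real n * H" "{L. L > 0 \<and> (\<exists>E D. code n L 0 E D)} \<noteq> {}"
proof -
  have "(\<integral>\<^sup>+z. ennreal (total_info n z) \<partial>Pw n) = ennreal (real n * H)"
    using total_info_mean[of n] total_info_nonneg
    by (subst nn_integral_eq_integral[OF total_info_integrable]) auto
  then have codes: "\<exists>E D. code n L 0 E D" if "real n * H < L" for L
    by (intro code_exists[where T="\<lambda>_. 0"]) (use that in \<open>auto intro: ennreal_leI\<close>)
  have "0 \<le> real n * H" using H_nonneg by simp
  then show "opt_length n 0 \<le> real n * H" "{L. L > 0 \<and> (\<exists>E D. code n L 0 E D)} \<noteq> {}"
    using opt_length_le[OF codes] by blast+
qed

lemma opt_length_upper_1:
  "opt_length n 1 \<le> 0" "{L. L > 0 \<and> (\<exists>E D. code n L 1 E D)} \<noteq> {}"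
proof -
  interpret Q: prob_space "Pw n" by (rule prob_Pw)
  have codes: "\<exists>E D. code n L 1 E D" for L
    by (intro code_exists[where T="\<lambda>_. 1"]) (auto simp: Q.emeasure_space_1)
  then show "opt_length n 1 \<le> 0" "{L. L > 0 \<and> (\<exists>E D. code n L 1 E D)} \<noteq> {}"
    using opt_length_le[of 0 n 1] by blast+
qed

lemma code_length_lower_hinge:
  assumes code: "code n L \<epsilon> E D" and n: "n \<ge> 1" and \<epsilon>: "0 \<le> \<epsilon>" "\<epsilon> \<le> 1" and L: "0 \<le> L"
  shows "real n * (1 - \<epsilon>) * H - (hinge y (var n) - y * \<epsilon>) - rem n
    \<le> (1 + 1 / real n) * L + (2 + log 2 (real n)) + 1 / ln 2"
proof -
  interpret Q: prob_space "Pw n" by (rule prob_Pw)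
  define t where "t = real n * H - y"
  have min_int: "integrable (Pw n) (\<lambda>z. min (total_info n z) t)" using total_info_integrable by auto
  have "(\<integral>z. min (total_info n z) t \<partial>Pw n) = (\<integral>z. total_info n z - max 0 (total_info n z - t) \<partial>Pw n)"
    by (intro Bochner_Integration.integral_cong) (auto simp: min_def max_def)
  also have "\<dots> = real n * H - excess n t"
    unfolding excess_def total_info_mean[symmetric]
    using total_info_integrable by (intro Bochner_Integration.integral_diff) auto
  finally have 1: "(\<integral>z. min (total_info n z) t \<partial>Pw n) = real n * H - excess n t" .
  have "(\<integral>z. min (total_info n z) t \<partial>Pw n)
      \<le> t * \<epsilon> + ((1 + 1 / real n) * L + (2 + log 2 (real n))) + 1 / ln 2"
  proof (cases "0 \<le> t")
    case True
    then show ?thesis using code_length_lower_bound[OF code n True \<epsilon>(1) L] by simp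
  next
    \<comment> \<open>A negative threshold needs no coding argument: the minimum is at most
      \<open>t\<close>, and \<open>t \<le> t * \<epsilon>\<close>.\<close>
    case False
    have "(\<integral>z. min (total_info n z) t \<partial>Pw n) \<le> (\<integral>z. t \<partial>Pw n)"
      by (intro integral_mono min_int) auto
    also have "\<dots> \<le> t * \<epsilon>" using False \<epsilon> mult_left_mono_neg[of \<epsilon> 1 t] by (simp add: Q.prob_space)
    moreover have "0 \<le> (1 + 1 / real n) * L + (2 + log 2 (real n)) + 1 / ln 2" using n L by simp
    ultimately show ?thesis by linarith
  qed
  then have "real n * H - t * \<epsilon> - (hinge y (var n) + rem n)
      \<le> (1 + 1 / real n) * L + (2 + log 2 (real n)) + 1 / ln 2"
    using excess_hinge[of n y] unfolding 1 t_def[symmetric] by linarith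
  then show ?thesis unfolding t_def by (simp add: algebra_simps)
qed

lemma sqrt_var_le: "sqrt (var n) \<le> sqrt (real n * W.Vw) + 1"
  using sqrt_add_le_add_sqrt[of 1 "real n * W.Vw"] W.Vw_nonneg by (simp add: var_def)

lemma code_length_lower:
  assumes code: "code n L \<epsilon> E D" and n: "n \<ge> 1" and \<epsilon>: "0 \<le> \<epsilon>" "\<epsilon> \<le> 1" and L: "0 \<le> L"
  shows "real n * (1 - \<epsilon>) * H - sqrt (real n * W.Vw) * fG \<epsilon> - (rem n + H + log 2 (real n) + 1 / ln 2 + 3) \<le> L"
proof -
  define A where "A = real n * (1 - \<epsilon>) * H - sqrt (real n * W.Vw) * fG \<epsilon> - 1 - rem n"
  define k where "k = 2 + log 2 (real n) + 1 / ln 2"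
  have k: "0 \<le> k" using n by (simp add: k_def)
  note low = code_length_lower_hinge[OF code n \<epsilon> L]
  have "A \<le> (1 + 1 / real n) * L + k"
  proof -
    consider "\<epsilon> = 0" | "\<epsilon> = 1" | "0 < \<epsilon>" "\<epsilon> < 1" using \<epsilon> by linarith
    then show ?thesis
    proof cases
      case 1
      then show ?thesis
        using low[of "- var n"] hinge_minus_le_1[OF var_ge_1[of n]] by (simp add: A_def k_def fG_def)
    next
      case 2
      then have "A \<le> 0" using rem_nonneg[of n] by (simp add: A_def fG_def)
      moreover have "0 \<le> (1 + 1 / real n) * L + k" using L k by simp
      ultimately show ?thesis by linarith
    next
      case 3
      then obtain x where x: "Phi x = \<epsilon>" using Phi_surj by blast
      have "hinge (sqrt (var n) * x) (var n) - sqrt (var n) * x * \<epsilon> = sqrt (var n) * fG \<epsilon>"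
        using hinge_legendre(2)[of "var n" x] var_ge_1[of n] 3 unfolding x by simp
      moreover have "sqrt (var n) * fG \<epsilon> \<le> (sqrt (real n * W.Vw) + 1) * fG \<epsilon>"
        by (intro mult_right_mono sqrt_var_le fG_nonneg)
      moreover have "(sqrt (real n * W.Vw) + 1) * fG \<epsilon> \<le> sqrt (real n * W.Vw) * fG \<epsilon> + 1"
        using fG_le_1[of \<epsilon>] by (simp add: algebra_simps)
      ultimately show ?thesis
        using low[of "sqrt (var n) * x"] unfolding A_def k_def by linarith
    qed
  qed
  moreover have "A \<le> real n * H"
  proof -
    have "real n * (1 - \<epsilon>) * H \<le> real n * 1 * H"
      using \<epsilon> H_nonneg by (intro mult_right_mono mult_left_mono) auto
    moreover have "0 \<le> sqrt (real n * W.Vw) * fG \<epsilon>" using fG_nonneg W.Vw_nonneg by simp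
    ultimately show ?thesis using rem_nonneg[of n] by (simp add: A_def)
  qed
  \<comment> \<open>This removes the factor \<open>1 + 1 / n\<close>: either \<open>L\<close>
    exceeds \<open>n * H\<close>, which already exceeds \<open>A\<close>, or the surplus
    \<open>L / n\<close> is at most \<open>H\<close>.\<close>
  ultimately have "A - k - H \<le> L"
  proof (cases "real n * H \<le> L")
    case False
    then have "L / real n \<le> H" using n by (simp add: field_simps)
    then show ?thesis using \<open>A \<le> (1 + 1 / real n) * L + k\<close> by (simp add: algebra_simps)
  qed (use k H_nonneg in linarith)
  then show ?thesis by (simp add: A_def k_def)
qed

lemma opt_length_approx:
  assumes n: "n \<ge> 1" and \<epsilon>: "0 \<le> \<epsilon>" "\<epsilon> \<le> 1"
  shows "\<bar>opt_length n \<epsilon> - (real n * (1 - \<epsilon>) * H - sqrt (real n * W.Vw) * fG \<epsilon>)\<bar>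
    \<le> rem n + H + log 2 (real n) + 1 / ln 2 + 3"
proof -
  let ?A = "{L. L > 0 \<and> (\<exists>E D. code n L \<epsilon> E D)}"
  let ?m = "real n * (1 - \<epsilon>) * H - sqrt (real n * W.Vw) * fG \<epsilon>"
  have "?A \<noteq> {} \<and> opt_length n \<epsilon> \<le> ?m + 1 + rem n"
  proof -
    consider "\<epsilon> = 0" | "\<epsilon> = 1" | "0 < \<epsilon>" "\<epsilon> < 1" using \<epsilon> by linarith
    then show ?thesis
    proof cases
      case 1
      then show ?thesis using opt_length_upper_0[of n] rem_nonneg[of n] by (simp add: fG_def)
    next
      case 2
      then show ?thesis using opt_length_upper_1[of n] rem_nonneg[of n] by (simp add: fG_def)
    next
      case 3
      have "sqrt (real n * W.Vw) * fG \<epsilon> \<le> sqrt (var n) * fG \<epsilon>"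
        by (intro mult_right_mono fG_nonneg) (simp add: var_def)
      then show ?thesis using opt_length_upper[OF 3, of n] by simp
    qed
  qed
  moreover from this have "?m - (rem n + H + log 2 (real n) + 1 / ln 2 + 3) \<le> opt_length n \<epsilon>"
    unfolding opt_length_def using code_length_lower[OF _ n \<epsilon>]
    by (intro cInf_greatest) auto
  moreover have "0 \<le> H + log 2 (real n) + 1 / ln 2" using H_nonneg n by simp
  ultimately show ?thesis unfolding abs_le_iff by linarith
qed

lemma opt_length_asymp:
  assumes \<epsilon>: "0 \<le> \<epsilon>" "\<epsilon> \<le> 1"
  shows "(\<lambda>n. opt_length n \<epsilon> - (real n * (1 - \<epsilon>) * H - sqrt (real n * W.Vw) * fG \<epsilon>))
    \<in> O(\<lambda>n. ln (real n))"
proof -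
  obtain C where C: "C \<ge> 0" "\<And>n. n \<ge> 1 \<Longrightarrow> (\<Sum>k<n. W.Kw / (1 + real k * W.Vw)) \<le> C * (1 + ln (real n))"
    using W.sum_Kw_log_bound by metis
  show ?thesis
  \<comment> \<open>For \<open>n \<ge> 3\<close> the logarithm is at least 1 and absorbs constants:
    \<open>rem n\<close> contributes \<open>2 * C + 1\<close>, and \<open>log 2 n\<close> and the
    additive \<open>1 / ln 2\<close> contribute \<open>1 / ln 2\<close> each.\<close>
  proof (rule bigoI[where c="2 * C + H + 2 / ln 2 + 4"])
    show "\<forall>\<^sub>F n in sequentially.
        norm (opt_length n \<epsilon> - (real n * (1 - \<epsilon>) * H - sqrt (real n * W.Vw) * fG \<epsilon>))
        \<le> (2 * C + H + 2 / ln 2 + 4) * norm (ln (real n))"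
      using eventually_ge_at_top[of 3]
    proof eventually_elim
      case (elim n)
      have "exp 1 \<le> real n" using exp_le elim by linarith
      then have l: "1 \<le> ln (real n)" using elim by (simp add: ln_ge_iff)
      have "rem n \<le> 1 + C * (1 + ln (real n))" using C(2)[of n] elim by (simp add: rem_def)
      also have "\<dots> \<le> ln (real n) + C * (2 * ln (real n))"
        using l C(1) by (intro add_mono mult_left_mono) auto
      finally have 1: "rem n \<le> ln (real n) + 2 * C * ln (real n)" by simp
      have 2: "H \<le> H * ln (real n)" using l H_nonneg mult_left_mono[of 1 "ln (real n)" H] by simp
      have 3: "1 / ln 2 \<le> 1 / ln 2 * ln (real n)"
        using l mult_left_mono[of 1 "ln (real n)" "1 / ln 2 :: real"] by simp
      have 4: "log 2 (real n) = 1 / ln 2 * ln (real n)" by (simp add: log_def)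
      have "rem n + H + log 2 (real n) + 1 / ln 2 + 3
          \<le> (2 * C + H + 2 / ln 2 + 4) * ln (real n)"
        using 1 2 3 4 l by (simp add: algebra_simps)
      moreover have "\<bar>opt_length n \<epsilon> - (real n * (1 - \<epsilon>) * H - sqrt (real n * W.Vw) * fG \<epsilon>)\<bar>
          \<le> rem n + H + log 2 (real n) + 1 / ln 2 + 3"
        by (rule opt_length_approx[OF _ \<epsilon>]) (use elim in simp)
      ultimately show ?case using l by simp
    qed
  qed
qed

end

section \<open>Conditional distributions\<close>

text \<open>A version of the conditional distribution that is a subprobability mass function for every
  value of the side information, not just almost everywhere.\<close>

definition sub_version :: "(nat \<Rightarrow> 'b \<Rightarrow> real) \<Rightarrow> nat \<Rightarrow> 'b \<Rightarrow> real" where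
  "sub_version p x y = (if (\<forall>x. 0 \<le> p x y) \<and> (\<forall>m. (\<Sum>x<m. p x y) \<le> 1) then p x y else 0)"

lemma sub_version_nonneg: "0 \<le> sub_version p x y"
  by (simp add: sub_version_def)

lemma sub_version_sum: "(\<Sum>x<m. sub_version p x y) \<le> 1"
proof (cases "(\<forall>x. 0 \<le> p x y) \<and> (\<forall>m. (\<Sum>x<m. p x y) \<le> 1)")
  case False
  show ?thesis unfolding sub_version_def if_not_P[OF False] by simp
qed (simp add: sub_version_def)

lemma sub_version_measurable:
  assumes [measurable]: "\<And>x. p x \<in> borel_measurable N"
  shows "sub_version p x \<in> borel_measurable N"
  unfolding sub_version_def by measurable

text \<open>The conditional expectations are nonnegative, and their partial sums at most 1, almost
  everywhere. Only countably many such inequalities occur, so the truncation in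
  \<open>sub_version\<close> is almost surely invisible along \<open>Y\<close>.\<close>

lemma
  fixes p :: "nat \<Rightarrow> 'b \<Rightarrow> real"
  assumes M: "prob_space M"
    and X[measurable]: "X \<in> M \<rightarrow>\<^sub>M count_space UNIV" and Y[measurable]: "Y \<in> M \<rightarrow>\<^sub>M N"
    and p: "is_cond_pmf M X N Y p"
  shows AE_sub_version: "AE w in M. \<forall>x. sub_version p x (Y w) = p x (Y w)"
    and cond_source_PXY: "cond_source N (distr M N Y) (PXY M X N Y) (sub_version p)"
proof -
  interpret M: prob_space M by (rule M)
  define G where "G = vimage_algebra (space M) Y N"
  define f :: "nat \<Rightarrow> 'a \<Rightarrow> real" where "f = (\<lambda>x. indicator {w \<in> space M. X w = x})"
  have pm[measurable]: "p x \<in> borel_measurable N" for x using p by (simp add: is_cond_pmf_def)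
  have pG: "AE w in M. p x (Y w) = real_cond_exp M G (f x) w" for x
    using p by (simp add: is_cond_pmf_def G_def f_def)
  have sub: "subalgebra M G"
    unfolding G_def subalgebra_def using measurable_sets[OF Y] measurable_space[OF Y]
    by (auto simp: sets_vimage_algebra2 Pi_iff)
  then interpret G: finite_measure_subalgebra M G
    by unfold_locales
  have f_meas[measurable]: "f x \<in> borel_measurable M" for x unfolding f_def by measurable
  have f_int: "integrable M (f x)" for x
    by (rule M.integrable_const_bound[where B=1]) (auto simp: f_def)
  have pos: "AE w in M. 0 \<le> real_cond_exp M G (f x) w" for x
    by (rule G.real_cond_exp_pos) (auto simp: f_def)
  have sum: "AE w in M. (\<Sum>x<m. real_cond_exp M G (f x) w) \<le> 1" for m
  proof -
    have "AE w in M. real_cond_exp M G (\<lambda>w. \<Sum>x<m. f x w) w = (\<Sum>x<m. real_cond_exp M G (f x) w)"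
      by (rule G.real_cond_exp_sum) (rule f_int)
    moreover have "AE w in M. real_cond_exp M G (\<lambda>w. \<Sum>x<m. f x w) w \<le> 1"
    proof (rule G.real_cond_exp_le_c)
      show "AE w in M. (\<Sum>x<m. f x w) \<le> 1"
      proof (rule AE_I2)
        fix w assume "w \<in> space M"
        then have "(\<Sum>x<m. f x w) = (\<Sum>x<m. if x = X w then 1 else 0)"
          by (intro sum.cong) (auto simp: f_def indicator_def)
        then show "(\<Sum>x<m. f x w) \<le> 1" by simp
      qed
    qed (use f_int in auto)
    ultimately show ?thesis by eventually_elim simp
  qed
  have "AE w in M. \<forall>x. p x (Y w) = real_cond_exp M G (f x) w"
    using pG by (simp add: AE_all_countable)
  moreover have "AE w in M. \<forall>x. 0 \<le> real_cond_exp M G (f x) w"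
    using pos by (simp add: AE_all_countable)
  moreover have "AE w in M. \<forall>m. (\<Sum>x<m. real_cond_exp M G (f x) w) \<le> 1"
    using sum by (simp add: AE_all_countable)
  ultimately show AE_eq: "AE w in M. \<forall>x. sub_version p x (Y w) = p x (Y w)"
    by eventually_elim (simp add: sub_version_def)
  show "cond_source N (distr M N Y) (PXY M X N Y) (sub_version p)"
  proof (rule cond_source.intro)
    show "prob_space (distr M N Y)" by (rule M.prob_space_distr) (rule Y)
    show "prob_space (PXY M X N Y)"
      unfolding PXY_def by (rule M.prob_space_distr) measurable
    show "sub_version p x \<in> borel_measurable N" for x by (rule sub_version_measurable) (rule pm)
    fix x A assume A[measurable]: "A \<in> sets N"
    have B: "Y -` A \<inter> space M \<in> sets G" unfolding G_def by (rule in_vimage_algebra) (rule A)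
    have B'[measurable]: "Y -` A \<inter> space M \<in> sets M" by (rule measurable_sets[OF Y A])
    have [measurable]: "sub_version p x \<in> borel_measurable N" by (rule sub_version_measurable) (rule pm)
    have "emeasure (PXY M X N Y) ({x} \<times> A)
        = emeasure M ((\<lambda>w. (X w, Y w)) -` ({x} \<times> A) \<inter> space M)"
      unfolding PXY_def by (rule emeasure_distr) measurable
    also have "(\<lambda>w. (X w, Y w)) -` ({x} \<times> A) \<inter> space M
        = {w \<in> space M. X w = x} \<inter> (Y -` A \<inter> space M)" by auto
    also have "emeasure M \<dots> = ennreal (\<integral>w\<in>Y -` A \<inter> space M. f x w \<partial>M)"
      unfolding set_lebesgue_integral_def f_def
      by (simp add: M.emeasure_eq_measure indicator_inter_arith[symmetric] mult.commute Int_absorb2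
          flip: Int_assoc) (auto intro!: arg_cong[where f="measure M"])
    \<comment> \<open>The defining identity of conditional expectation; the preimage of
      \<open>A\<close> lies in \<open>G\<close>.\<close>
    also have "(\<integral>w\<in>Y -` A \<inter> space M. f x w \<partial>M) = (\<integral>w\<in>Y -` A \<inter> space M. real_cond_exp M G (f x) w \<partial>M)"
      by (rule G.real_cond_exp_intA[OF f_int B])
    also have "\<dots> = (\<integral>w. indicator A (Y w) * sub_version p x (Y w) \<partial>M)"
      unfolding set_lebesgue_integral_def
    proof (rule integral_cong_AE)
      show "AE w in M. indicator (Y -` A \<inter> space M) w *\<^sub>R real_cond_exp M G (f x) w
          = indicator A (Y w) * sub_version p x (Y w)"
        using AE_eq pG[of x] AE_space
        by eventually_elim (auto split: split_indicator)
    qed measurable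
    also have "ennreal \<dots> = (\<integral>\<^sup>+w. ennreal (indicator A (Y w) * sub_version p x (Y w)) \<partial>M)"
    proof (rule nn_integral_eq_integral[symmetric])
      have le1: "sub_version p x y \<le> 1" for y
        using member_le_sum[of x "{..<Suc x}" "\<lambda>x. sub_version p x y"] sub_version_sum[of p y "Suc x"]
        by (simp add: sub_version_nonneg)
      show "integrable M (\<lambda>w. indicator A (Y w) * sub_version p x (Y w))"
        by (rule M.integrable_const_bound[where B=1])
          (auto simp: le1 sub_version_nonneg split: split_indicator)
    qed (simp add: sub_version_nonneg)
    also have "\<dots> = (\<integral>\<^sup>+y. ennreal (sub_version p x y) * indicator A y \<partial>distr M N Y)"
      by (subst nn_integral_distr) (auto intro!: nn_integral_cong split: split_indicator)
    finally show "emeasure (PXY M X N Y) ({x} \<times> A)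
        = (\<integral>\<^sup>+y\<in>A. ennreal (sub_version p x y) \<partial>distr M N Y)" .
  qed (auto simp: PXY_def sub_version_nonneg sub_version_sum)
qed

theorem theorem2:
  fixes M :: "'a measure" and N :: "'b measure"
    and X :: "'a \<Rightarrow> nat" and Y :: "'a \<Rightarrow> 'b" and p :: "nat \<Rightarrow> 'b \<Rightarrow> real"
    and \<epsilon> :: real
  assumes "prob_space M"
    and "X \<in> M \<rightarrow>\<^sub>M count_space UNIV" and "\<forall>w\<in>space M. 1 \<le> X w"
    and "Y \<in> M \<rightarrow>\<^sub>M N"
    and "is_cond_pmf M X N Y p"
    and "condT_finite M X Y p"
    and "0 \<le> \<epsilon>" and "\<epsilon> \<le> 1"
  shows "(\<lambda>n. Lstar_avg M X N Y n \<epsilon>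
            - (real n * (1 - \<epsilon>) * condH M X Y p
               - sqrt (real n * condV M X Y p) * fG \<epsilon>))
         \<in> O(\<lambda>n. ln (real n))"
proof -
  note [measurable] = assms(2,4)
  interpret cond_source N "distr M N Y" "PXY M X N Y" "sub_version p"
    by (rule cond_source_PXY[OF assms(1,2,4,5)])
  have XY[measurable]: "(\<lambda>w. (X w, Y w)) \<in> M \<rightarrow>\<^sub>M count_space UNIV \<Otimes>\<^sub>M N" by measurable
  have int: "integrable M (cinfo X Y p)" and third: "integrable M (\<lambda>w. \<bar>cinfo X Y p w - condH M X Y p\<bar> ^ 3)"
    using assms(6) by (auto simp: condT_finite_def)
  have cinfo_meas[measurable]: "cinfo X Y p \<in> borel_measurable M" using int by simp
  have info_meas[measurable]: "(\<lambda>w. info (X w, Y w)) \<in> borel_measurable M"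
    by (rule measurable_compose[OF XY info_measurable])
  have AE_info: "AE w in M. info (X w, Y w) = cinfo X Y p w"
    using AE_sub_version[OF assms(1,2,4,5)] by eventually_elim (simp add: info_def cinfo_def)
  \<comment> \<open>Stated for general \<open>g\<close> because it is applied to the mean, the
    variance and the absolute third moment.\<close>
  have integral_info: "(\<integral>z. g (info z) \<partial>PXY M X N Y) = (\<integral>w. g (cinfo X Y p w) \<partial>M)"
    and integrable_info: "integrable (PXY M X N Y) (\<lambda>z. g (info z)) \<longleftrightarrow> integrable M (\<lambda>w. g (cinfo X Y p w))"
    if g[measurable]: "g \<in> borel_measurable borel" for g :: "real \<Rightarrow> real"
  proof -
    have "(\<integral>z. g (info z) \<partial>PXY M X N Y) = (\<integral>w. g (info (X w, Y w)) \<partial>M)"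
      unfolding PXY_def by (rule integral_distr) measurable
    also have "\<dots> = (\<integral>w. g (cinfo X Y p w) \<partial>M)"
      by (rule integral_cong_AE) (use AE_info in auto)
    finally show "(\<integral>z. g (info z) \<partial>PXY M X N Y) = (\<integral>w. g (cinfo X Y p w) \<partial>M)" .
    have "integrable (PXY M X N Y) (\<lambda>z. g (info z)) \<longleftrightarrow> integrable M (\<lambda>w. g (info (X w, Y w)))"
      unfolding PXY_def by (rule integrable_distr_eq) measurable
    also have "\<dots> \<longleftrightarrow> integrable M (\<lambda>w. g (cinfo X Y p w))"
      by (rule integrable_cong_AE) (use AE_info in auto)
    finally show "integrable (PXY M X N Y) (\<lambda>z. g (info z)) \<longleftrightarrow> integrable M (\<lambda>w. g (cinfo X Y p w))" .
  qed
  have H_eq: "(\<integral>z. info z \<partial>PXY M X N Y) = condH M X Y p"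
    using integral_info[of "\<lambda>x. x"] by (simp add: condH_def)
  interpret cond_source_third_moment N "distr M N Y" "PXY M X N Y" "sub_version p"
  proof
    show "integrable (PXY M X N Y) info"
      using integrable_info[of "\<lambda>x. x"] int by simp
    show "integrable (PXY M X N Y) (\<lambda>z. \<bar>info z - (\<integral>z. info z \<partial>PXY M X N Y)\<bar> ^ 3)"
      unfolding H_eq using integrable_info[of "\<lambda>x. \<bar>x - condH M X Y p\<bar> ^ 3"] third by simp
  qed
  have "H = condH M X Y p" unfolding H_def by (rule H_eq)
  moreover have "W.Vw = condV M X Y p"
    unfolding W.Vw_def condV_def unfolding \<open>H = condH M X Y p\<close>
    by (rule integral_info[of "\<lambda>x. (x - condH M X Y p)\<^sup>2"]) measurable
  moreover have "opt_length n \<epsilon> = Lstar_avg M X N Y n \<epsilon>" for n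
    by (simp add: opt_length_def Lstar_avg_def code_def avg_code_def Pn_def)
  ultimately show ?thesis using opt_length_asymp[OF assms(7,8)] by simp
qed

end
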